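(* Let $\beta_0\in\tilde\Theta(s_n,M)$ with support $S_0$ of size $s=|S_0|$, and let $\pi\equiv\pi_{\lambda,S_0}(\beta)=(\lambda/2)^{s}e^{-\lambda\|\beta\|_1}$ be the Laplace prior supported on $S_0$ (i.e. on vectors $\beta\in\mathbb{R}^p$ with $\beta_i=0$ for $i\notin S_0$), with $\lambda>0$. Under the Design Assumption (stated in the context, with constants $0<b<1$, $d>0$), $$E_{Y\sim N(X\beta_0,I)}\log\Lambda_{n,\beta_0,\pi}(Y,X)\le\frac{s}{2}\left[1+2\lambda^2\,n(\log p)^d+C_0\sqrt{\frac{s}{n}\log p}+\log\left(\frac{8\pi}{n}\right)\right]-\lambda\|\beta_0\|_1,$$ where the constant $C_0$ depends on $\tilde\psi(S_0)$, $\phi(S_0)$ and $b$ (the $\pi$ inside $\log(8\pi/n)$ is the number $\pi$).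
   Context: $Y\sim N_n(X\beta_0,I)$ with $X$ an $n\times p$ matrix, $p>n$, with columns normalized so that $\|X^j\|_2=\sqrt n$; $\|X\|=\max_{1\le j\le p}\|X^j\|_2$. For $\beta\in\mathbb{R}^p$, $S_\beta=\{i:\beta_i\ne0\}$, $\beta_S=(\beta_i)_{i\in S}$, $\|\beta\|_0=|S_\beta|$; $S_0=S_{\beta_0}$; $X_0=X_{S_0}$ is the submatrix of columns of $X$ in $S_0$. Normalized likelihood and its marginal version: $\Delta_{n,\beta,\beta_0}(Y,X)=\exp\left\{-\frac12\|X(\beta-\beta_0)\|_2^2+(Y-X\beta_0)'X(\beta-\beta_0)\right\}$ and $\Lambda_{n,\beta_0,\pi}(Y,X)=\int\Delta_{n,\beta,\beta_0}(Y,X)\,\pi(\beta)\,d\beta$ (here the integral is over $\beta_{S_0}\in\mathbb{R}^{s}$). Compatibility number: $\phi(S)=\inf\left\{\frac{\|X\beta\|_2|S|^{1/2}}{\|X\|\,\|\beta_S\|_1}:\|\beta_{S^c}\|_1\le7\|\beta_S\|_1,\ \beta_S\ne0\right\}$. Smallest scaled singular value: $\tilde\phi(k)=\inf\left\{\frac{\|X\beta\|_2}{\|X\|\,\|\beta\|_2}:0\ne|S_\beta|\le k\right\}$. With $\bar\lambda=2\|X\|\sqrt{\log p}$ and a fixed constant $A_4>0$, $\tilde\psi(S)=\tilde\phi\left(\left(2+\frac{3}{A_4}+\frac{33}{\phi(S)^2}\frac{\lambda}{\bar\lambda}\right)|S|\right)$. Beta-min class (for a fixed constant $M>0$): $\tilde\Theta(s_n,M)=\left\{\beta_0\in\mathbb{R}^p:\|\beta_0\|_0\le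 s_n,\ \inf_{i\in S_0}|\beta_{0i}|\ge\beta_{min}\right\}$ with $\beta_{min}=\frac{M}{\tilde\psi(S_0)^2}\frac{\sqrt{|S_0|\log p}}{\|X\|\phi(S_0)}$. Design Assumption: $\|X_0\|=\sqrt n$ and for some $0<b<1$ and $d>0$, $$\frac{4\,\chi^2_{s,1/2}}{(1-b)^2\beta_{min}^2}<\lambda_{min}(X_0'X_0)<\lambda_{max}(X_0'X_0)\lesssim n(\log p)^d,$$ where $\chi^2_{s,1/2}$ is the median of the chi-squared distribution with $s$ degrees of freedom, $\lambda_{min},\lambda_{max}$ are the extreme eigenvalues, and $A\lesssim B$ means $A\le CB$ for some universal constant $C>0$. *)

theory Defs
  imports
    "HOL-Probability.Probability"
    "Jordan_Normal_Form.Spectral_Radius"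
    "Jordan_Normal_Form.DL_Submatrix"
begin

unbundle no vec_syntax
unbundle no inner_syntax

text \<open>Matrices and vectors are those of Jordan_Normal_Form, so that the dimensions are
  ordinary natural numbers and can be quantified over. The symbol \<open>\<bullet>\<close> is its scalar product,
  and indices start at 0.\<close>

definition supp :: "real vec \<Rightarrow> nat set" where
  "supp \<beta> = {i. i < dim_vec \<beta> \<and> \<beta> $ i \<noteq> 0}"

definition l2_norm :: "real vec \<Rightarrow> real" where
  "l2_norm v = sqrt (v \<bullet> v)"

definition l1_norm :: "real vec \<Rightarrow> real" where
  "l1_norm v = (\<Sum>i<dim_vec v. \<bar>v $ i\<bar>)"

definition l1_norm_on :: "nat set \<Rightarrow> real vec \<Rightarrow> real" where
  "l1_norm_on S v = (\<Sum>i \<in> S. \<bar>v $ i\<bar>)"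

definition col_norm :: "real mat \<Rightarrow> real" where
  "col_norm A = Max ((\<lambda>j. l2_norm (col A j)) ` {..<dim_col A})"

definition sub_cols :: "real mat \<Rightarrow> nat set \<Rightarrow> real mat" where
  "sub_cols A S = submatrix A UNIV S"

text \<open>The normal distribution with mean \<open>\<mu>\<close> and identity covariance matrix; its samples are
  functions on \<open>{..<dim_vec \<mu>}\<close>.\<close>

definition std_gaussian :: "real vec \<Rightarrow> (nat \<Rightarrow> real) measure" where
  "std_gaussian \<mu> = (\<Pi>\<^sub>M i\<in>{..<dim_vec \<mu>}. density lborel (normal_density (\<mu> $ i) 1))"

definition likelihood_ratio :: "real mat \<Rightarrow> real vec \<Rightarrow> real vec \<Rightarrow> real vec \<Rightarrow> real" where
  "likelihood_ratio X \<beta> \<beta>0 Y =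
     exp (- (1/2) * (l2_norm (X *\<^sub>v (\<beta> - \<beta>0)))\<^sup>2 + (Y - X *\<^sub>v \<beta>0) \<bullet> (X *\<^sub>v (\<beta> - \<beta>0)))"

definition embed :: "nat \<Rightarrow> nat set \<Rightarrow> (nat \<Rightarrow> real) \<Rightarrow> real vec" where
  "embed p S u = vec p (\<lambda>i. if i \<in> S then u i else 0)"

text \<open>Here \<open>prior\<close> is a density with respect to Lebesgue measure on the coordinate subspace
  of vectors supported in \<open>S\<close>.\<close>

definition marginal_likelihood ::
    "real mat \<Rightarrow> real vec \<Rightarrow> nat set \<Rightarrow> (real vec \<Rightarrow> real) \<Rightarrow> real vec \<Rightarrow> real" where
  "marginal_likelihood X \<beta>0 S prior Y =
     (\<integral>u. likelihood_ratio X (embed (dim_col X) S u) \<beta>0 Y * prior (embed (dim_col X) S u)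
        \<partial>(\<Pi>\<^sub>M i\<in>S. lborel))"

definition laplace_prior :: "real \<Rightarrow> nat set \<Rightarrow> real vec \<Rightarrow> real" where
  "laplace_prior lam S \<beta> = (lam / 2) ^ card S * exp (- lam * l1_norm \<beta>)"

definition compat_number :: "real mat \<Rightarrow> nat set \<Rightarrow> real" where
  "compat_number X S =
     Inf {l2_norm (X *\<^sub>v \<beta>) * sqrt (real (card S)) / (col_norm X * l1_norm_on S \<beta>) | \<beta>.
            \<beta> \<in> carrier_vec (dim_col X) \<and>
            l1_norm_on ({..<dim_col X} - S) \<beta> \<le> 7 * l1_norm_on S \<beta> \<and> (\<exists>i\<in>S. \<beta> $ i \<noteq> 0)}"

definition sparse_singular :: "real mat \<Rightarrow> real \<Rightarrow> real" where
  "sparse_singular X k =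
     Inf {l2_norm (X *\<^sub>v \<beta>) / (col_norm X * l2_norm \<beta>) | \<beta>.
            \<beta> \<in> carrier_vec (dim_col X) \<and> card (supp \<beta>) \<noteq> 0 \<and> real (card (supp \<beta>)) \<le> k}"

definition lambda_bar :: "real mat \<Rightarrow> real" where
  "lambda_bar X = 2 * col_norm X * sqrt (ln (real (dim_col X)))"

definition psi_tilde :: "real mat \<Rightarrow> real \<Rightarrow> real \<Rightarrow> nat set \<Rightarrow> real" where
  "psi_tilde X A4 lam S =
     sparse_singular X ((2 + 3 / A4 + 33 / (compat_number X S)\<^sup>2 * (lam / lambda_bar X)) * real (card S))"

definition beta_min :: "real mat \<Rightarrow> real \<Rightarrow> real \<Rightarrow> real \<Rightarrow> nat set \<Rightarrow> real" where
  "beta_min X A4 M lam S =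
     M / (psi_tilde X A4 lam S)\<^sup>2 *
     (sqrt (real (card S) * ln (real (dim_col X))) / (col_norm X * compat_number X S))"

text \<open>If \<open>compat_number\<close> or \<open>psi_tilde\<close> vanishes at the support, then \<open>beta_min\<close> is infinite and no
  vector with this support belongs to the class. As \<open>x / 0 = 0\<close> here, these cases have to be
  excluded explicitly.\<close>

definition beta_min_class :: "real mat \<Rightarrow> real \<Rightarrow> real \<Rightarrow> nat \<Rightarrow> real \<Rightarrow> real vec set" where
  "beta_min_class X A4 lam sn M =
     {\<beta>0 \<in> carrier_vec (dim_col X).
        card (supp \<beta>0) \<le> sn \<and> 0 < compat_number X (supp \<beta>0) \<and> 0 < psi_tilde X A4 lam (supp \<beta>0) \<and>
        (\<forall>i \<in> supp \<beta>0. beta_min X A4 M lam (supp \<beta>0) \<le> \<bar>\<beta>0 $ i\<bar>)}"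

definition chi_squared :: "nat \<Rightarrow> real measure" where
  "chi_squared s =
     distr (\<Pi>\<^sub>M i\<in>{..<s}. std_normal_distribution) borel (\<lambda>z. \<Sum>i<s. (z i)\<^sup>2)"

definition chi_squared_median :: "nat \<Rightarrow> real" where
  "chi_squared_median s = Inf {x. 1/2 \<le> cdf (chi_squared s) x}"

text \<open>These are meant for nonempty real symmetric matrices, whose set of real eigenvalues is
  finite and nonempty.\<close>

definition lambda_min :: "real mat \<Rightarrow> real" where
  "lambda_min A = Min (spectrum A)"

definition lambda_max :: "real mat \<Rightarrow> real" where
  "lambda_max A = Max (spectrum A)"

text \<open>The parameter \<open>C\<close> is the constant hidden in the upper bound on the largest eigenvalue.\<close>

definition design_assumption ::
    "real mat \<Rightarrow> real \<Rightarrow> real \<Rightarrow> real \<Rightarrow> real \<Rightarrow> nat set \<Rightarrow> real \<Rightarrow> real \<Rightarrow> bool" where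
  "design_assumption X A4 M C lam S b d \<longleftrightarrow>
     (let n = real (dim_row X); p = real (dim_col X); X0 = sub_cols X S; G = X0\<^sup>T * X0 in
        col_norm X0 = sqrt n \<and>
        4 * chi_squared_median (card S) / ((1 - b)\<^sup>2 * (beta_min X A4 M lam S)\<^sup>2) < lambda_min G \<and>
        lambda_min G < lambda_max G \<and>
        lambda_max G \<le> C * (n * ln p powr d))"

end

theory Submission
  imports Defs
begin

text \<open>Why the bound holds. Let \<open>s\<close> be the size of the support, \<open>\<psi>\<close> and \<open>\<phi>\<close> the values of \<open>psi_tilde\<close> and
\<open>compat_number\<close> at the support, \<open>X0\<close> the columns of the design in the support, and \<open>e\<close> the noise.

\<^bold>\<open>Probabilistic part.\<close> The prior density lies below its tangent exponential at \<open>\<beta>0\<close>, because the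
\<open>l1\<close> norm is convex. After this replacement the integrand of the marginal likelihood is the exponential of
a quadratic polynomial, with score \<open>w = X0' e - lam * sgn \<beta>0\<close>. The sparse singular value gives
\<open>X0' X0 \<ge> m\<close> with \<open>m = n * \<psi>\<^sup>2\<close>, so completing the square bounds the integrand by a product of one-dimensional
Gaussian kernels (\<open>laplace_integrand_le_gaussian\<close>). Integrating and taking logarithms leaves
\<open>s * ln (lam / 2) + s / 2 * ln (2 * pi / m) - lam * l1_norm \<beta>0\<close> plus half of \<open>w' (X0' X0)^(-1) w\<close>, where the
latter has mean at most \<open>s + lam\<^sup>2 * s / m\<close>: the noise enters through a projection of rank \<open>s\<close>. The result
is \<open>expected_ln_laplace_evidence_le\<close>; a lower bound on the integrand over a box of volume 1 ensures that the
logarithm is integrable.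

\<^bold>\<open>Deterministic part.\<close> It remains to compare
\<open>ln (lam\<^sup>2 / (16 * \<psi>\<^sup>2)) + lam\<^sup>2 / (n * \<psi>\<^sup>2)\<close> with
\<open>2 * lam\<^sup>2 * n * (ln p) powr d + C0 * sqrt (s / n * ln p)\<close>. If \<open>n * \<psi>\<^sup>2 > 1\<close>, the first term of the bound
suffices, since \<open>ln z \<le> z\<close>. If \<open>n * \<psi>\<^sup>2 \<le> 1\<close>, the constant \<open>C0\<close> has to do the work, and this is possible
because everything is then bounded in terms of \<open>\<psi>\<close> and \<open>\<phi>\<close>. First, \<open>p > n\<close> makes the sparse singular value
vanish at level \<open>n + 1\<close>; as the level used in \<open>psi_tilde\<close> increases linearly in \<open>lam / lambda_bar\<close>, positivity of
\<open>\<psi>\<close> bounds \<open>lam\<close> in terms of \<open>n\<close>, \<open>\<phi>\<close> and \<open>ln p\<close> (\<open>sparse_singular_wide_matrix\<close>). Second, any two columns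
are separated by a distance determined by \<open>\<psi>\<close>, so a pigeonhole argument bounds \<open>ln p\<close> (\<open>ln_dim_le_of_sparse_singular\<close>).\<close>

section \<open>Gram matrices and completing the square\<close>

text \<open>The Gram matrix \<open>g\<close> of the columns indexed by \<open>S\<close> is inverted inside a \<open>p\<close> by \<open>p\<close> matrix
that is the identity outside \<open>S\<close>, so that the index set need not be renumbered. Only a right
inverse is asked for: it solves the normal equations and determines the trace.\<close>
lemma gram_right_inverse:
  fixes x :: "'k \<Rightarrow> nat \<Rightarrow> real"
  assumes S: "finite S"
    and inj: "\<And>h. (\<Sum>k\<in>I. (\<Sum>j\<in>S. x k j * h j)\<^sup>2) = 0 \<Longrightarrow> \<forall>j\<in>S. h j = 0"
  obtains B where "\<And>i l. i \<in> S \<Longrightarrow> l \<in> S \<Longrightarrow>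
    (\<Sum>j\<in>S. (\<Sum>k\<in>I. x k i * x k j) * B j l) = (if i = l then 1 else 0)"
proof -
  obtain p where p: "S \<subseteq> {..<p}"
    using S finite_nat_iff_bounded by blast
  define g where "g i j = (if i \<in> S \<and> j \<in> S then \<Sum>k\<in>I. x k i * x k j else if i = j then 1 else 0)"
    for i j
  define G where "G = mat p p (\<lambda>(i, j). g i j)"
  have G: "G \<in> carrier_mat p p" by (simp add: G_def)
  have row_sum: "(\<Sum>j<p. g i j * f j) = (\<Sum>j\<in>S. (\<Sum>k\<in>I. x k i * x k j) * f j)" if "i \<in> S" for i f
    by (rule sum.mono_neutral_cong_right) (use that p in \<open>auto simp: g_def\<close>)
  have row_sum': "(\<Sum>j<p. g i j * f j) = f i" if "i \<notin> S" "i < p" for i and f :: "nat \<Rightarrow> real"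
  proof -
    have "(\<Sum>j<p. g i j * f j) = (\<Sum>j\<in>{i}. g i j * f j)"
      by (rule sum.mono_neutral_right) (use that in \<open>auto simp: g_def\<close>)
    then show ?thesis using that by (simp add: g_def)
  qed
  have mult: "(G *\<^sub>v v) $ i = (\<Sum>j<p. g i j * v $ j)" if "i < p" "v \<in> carrier_vec p" for i v
    using that by (simp add: G_def scalar_prod_def lessThan_atLeast0)
  have "det G \<noteq> 0"
  proof
    assume "det G = 0"
    then obtain v where v: "v \<in> carrier_vec p" "v \<noteq> 0\<^sub>v p" "G *\<^sub>v v = 0\<^sub>v p"
      using det_0_iff_vec_prod_zero[OF G] by blast
    have z: "(\<Sum>j<p. g i j * v $ j) = 0" if "i < p" for i
      using mult[OF that v(1)] v(3) that by simp
    have "(\<Sum>k\<in>I. (\<Sum>j\<in>S. x k j * v $ j)\<^sup>2)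
        = (\<Sum>k\<in>I. \<Sum>i\<in>S. v $ i * (\<Sum>j\<in>S. x k i * x k j * v $ j))"
      by (simp add: power2_eq_square sum_distrib_left sum_distrib_right mult_ac)
    also have "\<dots> = (\<Sum>i\<in>S. v $ i * (\<Sum>j\<in>S. (\<Sum>k\<in>I. x k i * x k j) * v $ j))"
      by (subst sum.swap, simp only: sum_distrib_left sum_distrib_right sum.swap[of _ I S] mult_ac)
    also have "\<dots> = (\<Sum>i\<in>S. v $ i * 0)"
    proof (intro sum.cong refl)
      fix i assume "i \<in> S"
      then show "v $ i * (\<Sum>j\<in>S. (\<Sum>k\<in>I. x k i * x k j) * v $ j) = v $ i * 0"
        using z[of i] row_sum[of i "\<lambda>j. v $ j"] p by auto
    qed
    finally have "(\<Sum>k\<in>I. (\<Sum>j\<in>S. x k j * v $ j)\<^sup>2) = 0" by simp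
    from inj[OF this] have "v $ j = 0" if "j < p" for j
      using z[OF that] row_sum'[of j "\<lambda>j. v $ j"] that by (cases "j \<in> S") auto
    with v show False by auto
  qed
  then have "G \<in> Units (ring_mat TYPE(real) p ())"
    by (rule det_non_zero_imp_unit[OF G])
  then obtain B where B: "B \<in> carrier_mat p p" "G * B = 1\<^sub>m p"
    unfolding Units_def ring_mat_def by auto
  have "(\<Sum>j\<in>S. (\<Sum>k\<in>I. x k i * x k j) * B $$ (j, l)) = (if i = l then 1 else 0)"
    if "i \<in> S" "l \<in> S" for i l
  proof -
    have il: "i < p" "l < p" using that p by auto
    have "(G * B) $$ (i, l) = (\<Sum>j<p. g i j * B $$ (j, l))"
      using il B(1) by (simp add: G_def scalar_prod_def lessThan_atLeast0)
    then show ?thesis using row_sum[OF that(1)] il B(2) by simp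
  qed
  then show ?thesis by (rule that)
qed

text \<open>If \<open>c\<close> solves the normal equations with right-hand side \<open>w\<close>, then the functional \<open>w\<close> is
represented by \<open>c\<close> in the inner product that \<open>x\<close> pulls back; this turns completing the square
into an identity between sums of squares.\<close>
lemma normal_equations_polarize:
  fixes x :: "'k \<Rightarrow> 'j \<Rightarrow> real"
  assumes "\<And>i. i \<in> S \<Longrightarrow> (\<Sum>j\<in>S. (\<Sum>k\<in>I. x k i * x k j) * c j) = w i"
  shows "(\<Sum>j\<in>S. w j * h j) = (\<Sum>k\<in>I. (\<Sum>j\<in>S. x k j * c j) * (\<Sum>j\<in>S. x k j * h j))"
proof -
  have "(\<Sum>j\<in>S. w j * h j) = (\<Sum>i\<in>S. \<Sum>j\<in>S. \<Sum>k\<in>I. x k i * x k j * c j * h i)"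
    by (intro sum.cong refl) (simp add: assms[symmetric] sum_distrib_left sum_distrib_right mult_ac)
  also have "\<dots> = (\<Sum>k\<in>I. \<Sum>i\<in>S. \<Sum>j\<in>S. x k i * x k j * c j * h i)"
    by (simp add: sum.swap[of _ I S])
  also have "\<dots> = (\<Sum>k\<in>I. (\<Sum>j\<in>S. x k j * c j) * (\<Sum>j\<in>S. x k j * h j))"
    unfolding sum_product
    by (rule sum.cong[OF refl], subst sum.swap) (simp add: mult_ac)
  finally show ?thesis .
qed

text \<open>The left-hand side equals its maximum, attained at \<open>h = c\<close>, minus half the energy of \<open>h - c\<close>;
coercivity bounds this energy from below by a multiple of the squared Euclidean distance. The
latter is a sum over coordinates, which makes the bound integrable coordinate by coordinate and
avoids the determinant of the Gram matrix.\<close>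
lemma complete_square_le:
  fixes x :: "'k \<Rightarrow> 'j \<Rightarrow> real"
  assumes c: "\<And>i. i \<in> S \<Longrightarrow> (\<Sum>j\<in>S. (\<Sum>k\<in>I. x k i * x k j) * c j) = w i"
    and m: "\<And>h. m * (\<Sum>j\<in>S. (h j)\<^sup>2) \<le> (\<Sum>k\<in>I. (\<Sum>j\<in>S. x k j * h j)\<^sup>2)"
  shows "(\<Sum>j\<in>S. w j * h j) - (1/2) * (\<Sum>k\<in>I. (\<Sum>j\<in>S. x k j * h j)\<^sup>2)
    \<le> (1/2) * (\<Sum>j\<in>S. w j * c j) - m / 2 * (\<Sum>j\<in>S. (h j - c j)\<^sup>2)"
proof -
  define L where "L f k = (\<Sum>j\<in>S. x k j * f j)" for f k
  have "L (\<lambda>j. h j - c j) k = L h k - L c k" for k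
    by (simp add: L_def algebra_simps sum_subtractf)
  then have "m * (\<Sum>j\<in>S. (h j - c j)\<^sup>2) \<le> (\<Sum>k\<in>I. (L h k - L c k)\<^sup>2)"
    using m[of "\<lambda>j. h j - c j"] by (simp add: L_def[symmetric])
  also have "\<dots> = (\<Sum>k\<in>I. (L h k)\<^sup>2) + (\<Sum>k\<in>I. L c k * L c k) - 2 * (\<Sum>k\<in>I. L c k * L h k)"
    unfolding sum.distrib[symmetric] sum_distrib_left sum_subtractf[symmetric]
    by (intro sum.cong refl) (simp add: power2_eq_square algebra_simps)
  finally have "m * (\<Sum>j\<in>S. (h j - c j)\<^sup>2)
    \<le> (\<Sum>k\<in>I. (L h k)\<^sup>2) + (\<Sum>k\<in>I. L c k * L c k) - 2 * (\<Sum>k\<in>I. L c k * L h k)" .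
  moreover have "(\<Sum>j\<in>S. w j * f j) = (\<Sum>k\<in>I. L c k * L f k)" for f
    unfolding L_def by (rule normal_equations_polarize[OF c])
  ultimately show ?thesis
    by (simp add: L_def[symmetric])
qed

text \<open>The inverse of a form bounded below by \<open>m\<close> is bounded above by \<open>1 / m\<close>. By the arithmetic-geometric
mean inequality \<open>2 w c \<le> m c\<^sup>2 + w\<^sup>2 / m\<close>, and the first term sums to at most \<open>w c\<close>.\<close>
lemma normal_equations_energy_le:
  fixes x :: "'k \<Rightarrow> 'j \<Rightarrow> real"
  assumes c: "\<And>i. i \<in> S \<Longrightarrow> (\<Sum>j\<in>S. (\<Sum>k\<in>I. x k i * x k j) * c j) = w i"
    and m: "\<And>h. m * (\<Sum>j\<in>S. (h j)\<^sup>2) \<le> (\<Sum>k\<in>I. (\<Sum>j\<in>S. x k j * h j)\<^sup>2)"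
    and "0 < m"
  shows "(\<Sum>j\<in>S. w j * c j) \<le> (\<Sum>j\<in>S. (w j)\<^sup>2) / m"
proof -
  have "2 * (w j * c j) \<le> m * (c j)\<^sup>2 + (w j)\<^sup>2 / m" for j
  proof -
    have "0 \<le> (m * c j - w j)\<^sup>2 / m" using \<open>0 < m\<close> by simp
    also have "\<dots> = m * (c j)\<^sup>2 + (w j)\<^sup>2 / m - 2 * (w j * c j)"
      using \<open>0 < m\<close> by (simp add: field_simps power2_eq_square)
    finally show ?thesis by simp
  qed
  then have "2 * (\<Sum>j\<in>S. w j * c j) \<le> m * (\<Sum>j\<in>S. (c j)\<^sup>2) + (\<Sum>j\<in>S. (w j)\<^sup>2) / m"
    unfolding sum_distrib_left sum_divide_distrib sum.distrib[symmetric] by (intro sum_mono)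
  also have "m * (\<Sum>j\<in>S. (c j)\<^sup>2) \<le> (\<Sum>j\<in>S. w j * c j)"
    using m[of c] by (simp add: normal_equations_polarize[of S x I c w, OF c] power2_eq_square)
  finally show ?thesis by simp
qed

section \<open>Gaussian product measures\<close>

lemma has_bochner_integral_PiM_prod:
  fixes f :: "'i \<Rightarrow> 'a \<Rightarrow> real"
  assumes "\<And>i. sigma_finite_measure (M i)" "finite I"
    and f: "\<And>i. i \<in> I \<Longrightarrow> has_bochner_integral (M i) (f i) (a i)"
  shows "has_bochner_integral (Pi\<^sub>M I M) (\<lambda>x. \<Prod>i\<in>I. f i (x i)) (\<Prod>i\<in>I. a i)"
proof -
  interpret product_sigma_finite M
    by (rule product_sigma_finite.intro) fact
  have int: "integrable (M i) (f i)" and eq: "integral\<^sup>L (M i) (f i) = a i" if "i \<in> I" for i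
    using f[OF that] by (simp_all add: has_bochner_integral_iff)
  show ?thesis
    using product_integrable_prod[OF \<open>finite I\<close> int] product_integral_prod[OF \<open>finite I\<close> int] eq
    by (simp add: has_bochner_integral_iff)
qed

lemma has_bochner_integral_gaussian_kernel:
  fixes m c :: real
  assumes "0 < m"
  shows "has_bochner_integral lborel (\<lambda>u. exp (- (m / 2) * (u - c)\<^sup>2)) (sqrt (2 * pi / m))"
proof -
  have "has_bochner_integral lborel (normal_density c (1 / sqrt m)) 1"
    using assms by (simp add: has_bochner_integral_iff)
  then have "has_bochner_integral lborel (\<lambda>u. sqrt (2 * pi / m) * normal_density c (1 / sqrt m) u)
      (sqrt (2 * pi / m) * 1)"
    by (rule has_bochner_integral_mult_right)
  moreover have "sqrt (2 * pi / m) * normal_density c (1 / sqrt m) u = exp (- (m / 2) * (u - c)\<^sup>2)" for u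
    using assms by (simp add: normal_density_def power_divide)
  ultimately show ?thesis by simp
qed

abbreviation gaussian_PiM :: "'i set \<Rightarrow> ('i \<Rightarrow> real) \<Rightarrow> ('i \<Rightarrow> real) measure" where
  "gaussian_PiM I \<mu> \<equiv> \<Pi>\<^sub>M i\<in>I. density lborel (normal_density (\<mu> i) 1)"

lemma prob_space_gaussian_PiM: "prob_space (gaussian_PiM I \<mu>)"
  by (intro prob_space_PiM prob_space_normal_density) simp

lemma has_bochner_integral_normal_density:
  assumes "f \<in> borel_measurable borel"
    and "has_bochner_integral lborel (\<lambda>u. normal_density \<mu> \<sigma> u * f u) a"
  shows "has_bochner_integral (density lborel (normal_density \<mu> \<sigma>)) f a"
  using assms by (intro has_bochner_integral_density) auto

text \<open>The product of two centred coordinates is a product over all coordinates of functions of one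
coordinate each: the factor at \<open>j\<close> is a centred moment of order 0, 1 or 2, according to how many
of \<open>i\<close> and \<open>k\<close> equal \<open>j\<close>.\<close>
lemma gaussian_PiM_covariance:
  assumes I: "finite I" "i \<in> I" "k \<in> I"
  shows "has_bochner_integral (gaussian_PiM I \<mu>) (\<lambda>y. (y i - \<mu> i) * (y k - \<mu> k)) (if i = k then 1 else 0)"
proof -
  define f where "f j t = (if j = i then t - \<mu> i else 1) * (if j = k then t - \<mu> k else 1)" for j t
  define a :: "'a \<Rightarrow> real" where "a j = (if j = i \<and> j \<noteq> k \<or> j = k \<and> j \<noteq> i then 0 else 1)" for j
  have "has_bochner_integral (density lborel (normal_density (\<mu> j) 1)) (f j) (a j)" for j
  proof (rule has_bochner_integral_normal_density)
    show "f j \<in> borel_measurable borel" unfolding f_def by measurable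
    show "has_bochner_integral lborel (\<lambda>u. normal_density (\<mu> j) 1 u * f j u) (a j)"
      using normal_moment_even[of 1 "\<mu> j" 0] normal_moment_even[of 1 "\<mu> j" 1]
        normal_moment_odd[of 1 "\<mu> j" 0]
      by (cases "j = i"; cases "j = k") (auto simp: f_def a_def power2_eq_square)
  qed
  then have "has_bochner_integral (gaussian_PiM I \<mu>) (\<lambda>y. \<Prod>j\<in>I. f j (y j)) (\<Prod>j\<in>I. a j)"
    by (intro has_bochner_integral_PiM_prod I prob_space_imp_sigma_finite prob_space_normal_density) simp_all
  moreover have "(\<Prod>j\<in>I. f j (y j)) = (y i - \<mu> i) * (y k - \<mu> k)" for y
    unfolding f_def prod.distrib using I by simp
  moreover have "(\<Prod>j\<in>I. a j) = (if i = k then 1 else 0)"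
    using I by (auto simp: a_def intro!: prod.neutral bexI[of _ i])
  ultimately show ?thesis by simp
qed

lemma gaussian_PiM_mean:
  assumes I: "finite I" "i \<in> I"
  shows "has_bochner_integral (gaussian_PiM I \<mu>) (\<lambda>y. y i - \<mu> i) 0"
proof -
  define f where "f j t = (if j = i then t - \<mu> i else 1)" for j t
  define a :: "'a \<Rightarrow> real" where "a j = (if j = i then 0 else 1)" for j
  have "has_bochner_integral (density lborel (normal_density (\<mu> j) 1)) (f j) (a j)" for j
  proof (rule has_bochner_integral_normal_density)
    show "f j \<in> borel_measurable borel" unfolding f_def by measurable
    show "has_bochner_integral lborel (\<lambda>u. normal_density (\<mu> j) 1 u * f j u) (a j)"
      using normal_moment_even[of 1 "\<mu> j" 0] normal_moment_odd[of 1 "\<mu> j" 0]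
      by (auto simp: f_def a_def)
  qed
  then have "has_bochner_integral (gaussian_PiM I \<mu>) (\<lambda>y. \<Prod>j\<in>I. f j (y j)) (\<Prod>j\<in>I. a j)"
    by (intro has_bochner_integral_PiM_prod I prob_space_imp_sigma_finite prob_space_normal_density) simp_all
  moreover have "(\<Prod>j\<in>I. f j (y j)) = y i - \<mu> i" for y
    unfolding f_def using I by simp
  moreover have "(\<Prod>j\<in>I. a j) = 0"
    using I by (auto simp: a_def)
  ultimately show ?thesis by simp
qed

lemma gaussian_PiM_affine_product:
  assumes I: "finite I"
  shows "has_bochner_integral (gaussian_PiM I \<mu>)
    (\<lambda>y. ((\<Sum>k\<in>I. a k * (y k - \<mu> k)) - \<alpha>) * ((\<Sum>k\<in>I. b k * (y k - \<mu> k)) - \<beta>))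
    ((\<Sum>k\<in>I. a k * b k) + \<alpha> * \<beta>)"
proof -
  interpret prob_space "gaussian_PiM I \<mu>" by (rule prob_space_gaussian_PiM)
  have lin: "has_bochner_integral (gaussian_PiM I \<mu>) (\<lambda>y. \<Sum>k\<in>I. a k * (y k - \<mu> k)) (\<Sum>k\<in>I. a k * 0)" for a
    by (intro has_bochner_integral_sum has_bochner_integral_mult_right gaussian_PiM_mean I)
  have quad: "has_bochner_integral (gaussian_PiM I \<mu>)
      (\<lambda>y. \<Sum>i\<in>I. \<Sum>k\<in>I. a i * b k * ((y i - \<mu> i) * (y k - \<mu> k)))
      (\<Sum>i\<in>I. \<Sum>k\<in>I. a i * b k * (if i = k then 1 else 0))"
    by (intro has_bochner_integral_sum has_bochner_integral_mult_right gaussian_PiM_covariance I)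
  have const: "has_bochner_integral (gaussian_PiM I \<mu>) (\<lambda>y. \<alpha> * \<beta>) (\<alpha> * \<beta>)"
    by (simp add: has_bochner_integral_iff prob_space)
  have "has_bochner_integral (gaussian_PiM I \<mu>)
    (\<lambda>y. (\<Sum>i\<in>I. \<Sum>k\<in>I. a i * b k * ((y i - \<mu> i) * (y k - \<mu> k)))
       - \<beta> * (\<Sum>k\<in>I. a k * (y k - \<mu> k)) - \<alpha> * (\<Sum>k\<in>I. b k * (y k - \<mu> k)) + \<alpha> * \<beta>)
    ((\<Sum>i\<in>I. \<Sum>k\<in>I. a i * b k * (if i = k then 1 else 0))
       - \<beta> * (\<Sum>k\<in>I. a k * 0) - \<alpha> * (\<Sum>k\<in>I. b k * 0) + \<alpha> * \<beta>)"
    by (intro has_bochner_integral_add has_bochner_integral_diff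
          has_bochner_integral_mult_right quad lin const)
  moreover have "((\<Sum>k\<in>I. a k * (y k - \<mu> k)) - \<alpha>) * ((\<Sum>k\<in>I. b k * (y k - \<mu> k)) - \<beta>)
     = (\<Sum>i\<in>I. \<Sum>k\<in>I. a i * b k * ((y i - \<mu> i) * (y k - \<mu> k)))
       - \<beta> * (\<Sum>k\<in>I. a k * (y k - \<mu> k)) - \<alpha> * (\<Sum>k\<in>I. b k * (y k - \<mu> k)) + \<alpha> * \<beta>" for y
  proof -
    have "(\<Sum>k\<in>I. a k * (y k - \<mu> k)) * (\<Sum>k\<in>I. b k * (y k - \<mu> k))
      = (\<Sum>i\<in>I. \<Sum>k\<in>I. a i * b k * ((y i - \<mu> i) * (y k - \<mu> k)))"
      unfolding sum_product by (intro sum.cong refl) simp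
    then show ?thesis by (simp add: left_diff_distrib right_diff_distrib mult.commute)
  qed
  moreover have "(\<Sum>i\<in>I. \<Sum>k\<in>I. a i * b k * (if i = k then 1 else 0)) = (\<Sum>k\<in>I. a k * b k)"
    using I by (simp add: if_distrib cong: if_cong)
  ultimately show ?thesis by simp
qed

section \<open>Marginal likelihood under a Laplace prior\<close>

text \<open>Likelihood ratio times Laplace density, written in coordinates: \<open>x\<close> is the design restricted to
the columns in \<open>S\<close>, \<open>b\<close> the true parameter, \<open>e\<close> the noise and \<open>u\<close> the parameter that is integrated
out.\<close>
definition laplace_integrand ::
    "('k \<Rightarrow> 'j \<Rightarrow> real) \<Rightarrow> 'k set \<Rightarrow> 'j set \<Rightarrow> ('j \<Rightarrow> real) \<Rightarrow> real \<Rightarrow> ('k \<Rightarrow> real) \<Rightarrow> ('j \<Rightarrow> real) \<Rightarrow> real" where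
  "laplace_integrand x I S b lam e u =
     exp (- (1/2) * (\<Sum>k\<in>I. (\<Sum>j\<in>S. x k j * (u j - b j))\<^sup>2)
          + (\<Sum>k\<in>I. e k * (\<Sum>j\<in>S. x k j * (u j - b j)))) *
     ((lam / 2) ^ card S * exp (- lam * (\<Sum>j\<in>S. \<bar>u j\<bar>)))"

text \<open>The absolute value lies above its tangent at \<open>b j\<close>, and since \<open>b\<close> itself attains equality the
factor \<open>exp (- lam * \<bar>b\<bar>)\<close> comes out without loss. What remains of the prior is linear in \<open>u\<close> and
shifts the score \<open>w\<close> by \<open>lam * sgn b\<close>; completing the square yields a product of
one-dimensional Gaussian kernels centred at \<open>b + c\<close>.\<close>
lemma laplace_integrand_le_gaussian:
  assumes lam: "0 < lam"
    and w: "\<And>j. j \<in> S \<Longrightarrow> w j = (\<Sum>k\<in>I. x k j * e k) - lam * sgn (b j)"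
    and c: "\<And>i. i \<in> S \<Longrightarrow> (\<Sum>j\<in>S. (\<Sum>k\<in>I. x k i * x k j) * c j) = w i"
    and m: "\<And>h. m * (\<Sum>j\<in>S. (h j)\<^sup>2) \<le> (\<Sum>k\<in>I. (\<Sum>j\<in>S. x k j * h j)\<^sup>2)"
    and S: "finite S"
  shows "laplace_integrand x I S b lam e u \<le>
    (lam / 2) ^ card S * exp (- lam * (\<Sum>j\<in>S. \<bar>b j\<bar>) + (1/2) * (\<Sum>j\<in>S. w j * c j)) *
    (\<Prod>j\<in>S. exp (- (m / 2) * (u j - (b j + c j))\<^sup>2))"
proof -
  define h where "h j = u j - b j" for j
  define Q where "Q = (\<Sum>k\<in>I. (\<Sum>j\<in>S. x k j * h j)\<^sup>2)"
  have noise: "(\<Sum>k\<in>I. e k * (\<Sum>j\<in>S. x k j * h j)) = (\<Sum>j\<in>S. (\<Sum>k\<in>I. x k j * e k) * h j)"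
    unfolding sum_distrib_left sum_distrib_right
    by (subst sum.swap) (simp add: mult_ac)
  have "\<bar>b j\<bar> + sgn (b j) * h j \<le> \<bar>u j\<bar>" for j
    by (auto simp: sgn_if h_def)
  then have "lam * (\<Sum>j\<in>S. \<bar>b j\<bar> + sgn (b j) * h j) \<le> lam * (\<Sum>j\<in>S. \<bar>u j\<bar>)"
    using lam by (intro mult_left_mono sum_mono) auto
  moreover have "(\<Sum>j\<in>S. w j * h j)
      = (\<Sum>j\<in>S. (\<Sum>k\<in>I. x k j * e k) * h j) - lam * (\<Sum>j\<in>S. sgn (b j) * h j)"
    by (simp add: w left_diff_distrib sum_subtractf sum_distrib_left mult.assoc)
  moreover have "(\<Sum>j\<in>S. w j * h j) - (1/2) * Q
    \<le> (1/2) * (\<Sum>j\<in>S. w j * c j) - m / 2 * (\<Sum>j\<in>S. (h j - c j)\<^sup>2)"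
    unfolding Q_def by (rule complete_square_le[OF c m])
  ultimately have "- (1/2) * Q + (\<Sum>k\<in>I. e k * (\<Sum>j\<in>S. x k j * h j)) - lam * (\<Sum>j\<in>S. \<bar>u j\<bar>)
    \<le> - lam * (\<Sum>j\<in>S. \<bar>b j\<bar>) + (1/2) * (\<Sum>j\<in>S. w j * c j) + (\<Sum>j\<in>S. - (m / 2) * (h j - c j)\<^sup>2)"
    unfolding noise sum_distrib_left[symmetric] by (simp add: sum.distrib distrib_left)
  then have "exp (- (1/2) * Q + (\<Sum>k\<in>I. e k * (\<Sum>j\<in>S. x k j * h j)) - lam * (\<Sum>j\<in>S. \<bar>u j\<bar>))
    \<le> exp (- lam * (\<Sum>j\<in>S. \<bar>b j\<bar>) + (1/2) * (\<Sum>j\<in>S. w j * c j)) * (\<Prod>j\<in>S. exp (- (m / 2) * (h j - c j)\<^sup>2))"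
    unfolding exp_sum[OF S, symmetric] exp_add[symmetric] by simp
  then have "(lam / 2) ^ card S *
      exp (- (1/2) * Q + (\<Sum>k\<in>I. e k * (\<Sum>j\<in>S. x k j * h j)) - lam * (\<Sum>j\<in>S. \<bar>u j\<bar>))
    \<le> (lam / 2) ^ card S *
      (exp (- lam * (\<Sum>j\<in>S. \<bar>b j\<bar>) + (1/2) * (\<Sum>j\<in>S. w j * c j)) * (\<Prod>j\<in>S. exp (- (m / 2) * (h j - c j)\<^sup>2)))"
    using lam by (intro mult_left_mono) auto
  moreover have "laplace_integrand x I S b lam e u = (lam / 2) ^ card S *
      exp (- (1/2) * Q + (\<Sum>k\<in>I. e k * (\<Sum>j\<in>S. x k j * h j)) - lam * (\<Sum>j\<in>S. \<bar>u j\<bar>))"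
    unfolding laplace_integrand_def Q_def h_def exp_diff by (simp add: exp_minus field_simps)
  ultimately show ?thesis
    by (simp only: h_def mult.assoc diff_diff_eq)
qed

text \<open>A crude lower bound that is exponential in a linear function of the noise: it makes the
logarithm of the marginal likelihood integrable from below.\<close>
lemma laplace_integrand_ge_on_unit_box:
  fixes x :: "'k \<Rightarrow> 'j \<Rightarrow> real" and b :: "'j \<Rightarrow> real"
  assumes lam: "0 < lam" and u: "\<And>j. j \<in> S \<Longrightarrow> u j \<in> {0..1}"
  defines "A \<equiv> \<lambda>k. \<Sum>j\<in>S. \<bar>x k j\<bar> * (1 + \<bar>b j\<bar>)"
  shows "laplace_integrand x I S b lam e u \<ge>
    (lam / 2) ^ card S *
    exp (- (1/2) * (\<Sum>k\<in>I. (A k)\<^sup>2) - (\<Sum>k\<in>I. A k * \<bar>e k\<bar>) - lam * real (card S))"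
proof -
  define L where "L k = (\<Sum>j\<in>S. x k j * (u j - b j))" for k
  have L: "\<bar>L k\<bar> \<le> A k" for k
    unfolding L_def A_def
  proof (rule order_trans[OF sum_abs], intro sum_mono)
    fix j assume "j \<in> S"
    then have "\<bar>u j - b j\<bar> \<le> 1 + \<bar>b j\<bar>" using u[of j] by auto
    then show "\<bar>x k j * (u j - b j)\<bar> \<le> \<bar>x k j\<bar> * (1 + \<bar>b j\<bar>)"
      unfolding abs_mult by (rule mult_left_mono) simp
  qed
  have "(\<Sum>k\<in>I. (L k)\<^sup>2) \<le> (\<Sum>k\<in>I. (A k)\<^sup>2)"
    by (intro sum_mono) (simp add: abs_le_square_iff[symmetric] order_trans[OF L abs_ge_self])
  moreover have "(\<Sum>k\<in>I. - (A k * \<bar>e k\<bar>)) \<le> (\<Sum>k\<in>I. e k * L k)"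
  proof (intro sum_mono)
    fix k
    have "- (e k * L k) \<le> \<bar>L k\<bar> * \<bar>e k\<bar>"
      by (metis abs_ge_minus_self abs_mult mult.commute)
    also have "\<dots> \<le> A k * \<bar>e k\<bar>" using L by (intro mult_right_mono) auto
    finally show "- (A k * \<bar>e k\<bar>) \<le> e k * L k" by simp
  qed
  moreover have "lam * (\<Sum>j\<in>S. \<bar>u j\<bar>) \<le> lam * real (card S)"
  proof -
    have "(\<Sum>j\<in>S. \<bar>u j\<bar>) \<le> (\<Sum>j\<in>S. 1)" using u by (intro sum_mono) auto
    then show ?thesis using lam by (intro mult_left_mono) auto
  qed
  ultimately have "exp (- (1/2) * (\<Sum>k\<in>I. (A k)\<^sup>2) - (\<Sum>k\<in>I. A k * \<bar>e k\<bar>) - lam * real (card S))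
    \<le> exp (- (1/2) * (\<Sum>k\<in>I. (L k)\<^sup>2) + (\<Sum>k\<in>I. e k * L k)) * exp (- lam * (\<Sum>j\<in>S. \<bar>u j\<bar>))"
    unfolding exp_add[symmetric] by (simp add: sum_negf)
  then have "(lam / 2) ^ card S *
      exp (- (1/2) * (\<Sum>k\<in>I. (A k)\<^sup>2) - (\<Sum>k\<in>I. A k * \<bar>e k\<bar>) - lam * real (card S))
    \<le> (lam / 2) ^ card S *
      (exp (- (1/2) * (\<Sum>k\<in>I. (L k)\<^sup>2) + (\<Sum>k\<in>I. e k * L k)) * exp (- lam * (\<Sum>j\<in>S. \<bar>u j\<bar>)))"
    using lam by (intro mult_left_mono) auto
  then show ?thesis
    unfolding laplace_integrand_def L_def by (simp only: mult_ac)
qed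

lemma measurable_laplace_integrand:
  assumes "finite S" "finite I"
    and e: "\<And>k. k \<in> I \<Longrightarrow> (\<lambda>z. e z k) \<in> borel_measurable N"
    and u: "\<And>j. j \<in> S \<Longrightarrow> (\<lambda>z. u z j) \<in> borel_measurable N"
  shows "(\<lambda>z. laplace_integrand x I S b lam (e z) (u z)) \<in> borel_measurable N"
  unfolding laplace_integrand_def
  by (intro borel_measurable_times borel_measurable_exp borel_measurable_add borel_measurable_sum
      borel_measurable_power borel_measurable_diff borel_measurable_abs borel_measurable_const
      borel_measurable_uminus e u
      borel_measurable_exp[THEN measurable_compose[rotated]])

text \<open>The Gaussian majorant integrates to a product of one-dimensional Gaussian integrals, and the unit
box on which the lower bound holds has volume 1.\<close>

lemma
  fixes x :: "'k \<Rightarrow> 'j \<Rightarrow> real" and b :: "'j \<Rightarrow> real"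
  assumes lam: "0 < lam" and m_pos: "0 < m" and S: "finite S" and I: "finite I"
    and w: "\<And>j. j \<in> S \<Longrightarrow> w j = (\<Sum>k\<in>I. x k j * e k) - lam * sgn (b j)"
    and c: "\<And>i. i \<in> S \<Longrightarrow> (\<Sum>j\<in>S. (\<Sum>k\<in>I. x k i * x k j) * c j) = w i"
    and m: "\<And>h. m * (\<Sum>j\<in>S. (h j)\<^sup>2) \<le> (\<Sum>k\<in>I. (\<Sum>j\<in>S. x k j * h j)\<^sup>2)"
  defines "s \<equiv> real (card S)"
    and "Z \<equiv> \<integral>u. laplace_integrand x I S b lam e u \<partial>(\<Pi>\<^sub>M j\<in>S. lborel)"
    and "A \<equiv> \<lambda>k. \<Sum>j\<in>S. \<bar>x k j\<bar> * (1 + \<bar>b j\<bar>)"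
  shows ln_laplace_evidence_le:
      "ln Z \<le> s * ln (lam / 2) + s / 2 * ln (2 * pi / m) - lam * (\<Sum>j\<in>S. \<bar>b j\<bar>) + (1/2) * (\<Sum>j\<in>S. w j * c j)"
    and ln_laplace_evidence_ge:
      "s * ln (lam / 2) - (1/2) * (\<Sum>k\<in>I. (A k)\<^sup>2) - (\<Sum>k\<in>I. A k * \<bar>e k\<bar>) - lam * s \<le> ln Z"
proof -
  define P where "P = (\<Pi>\<^sub>M j\<in>S. lborel :: real measure)"
  define f where "f = laplace_integrand x I S b lam e"
  define K where "K = (lam / 2) ^ card S * exp (- lam * (\<Sum>j\<in>S. \<bar>b j\<bar>) + (1/2) * (\<Sum>j\<in>S. w j * c j))"
  define L where "L = (lam / 2) ^ card S *
    exp (- (1/2) * (\<Sum>k\<in>I. (A k)\<^sup>2) - (\<Sum>k\<in>I. A k * \<bar>e k\<bar>) - lam * s)"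
  have KL: "0 < K" "0 < L" using lam by (auto simp: K_def L_def)
  have f_nonneg: "0 \<le> f u" for u using lam by (simp add: f_def laplace_integrand_def)
  have upper: "has_bochner_integral P (\<lambda>u. K * (\<Prod>j\<in>S. exp (- (m / 2) * (u j - (b j + c j))\<^sup>2)))
      (K * (\<Prod>j\<in>S. sqrt (2 * pi / m)))"
    unfolding P_def
    by (intro has_bochner_integral_mult_right has_bochner_integral_PiM_prod
        has_bochner_integral_gaussian_kernel m_pos S sigma_finite_lborel)
  have f_le: "f u \<le> K * (\<Prod>j\<in>S. exp (- (m / 2) * (u j - (b j + c j))\<^sup>2))" for u
    unfolding f_def K_def by (rule laplace_integrand_le_gaussian[OF lam w c m S])
  have lower: "has_bochner_integral P (\<lambda>u. L * (\<Prod>j\<in>S. indicator {0..1} (u j))) (L * (\<Prod>j\<in>S. 1))"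
    unfolding P_def
    by (intro has_bochner_integral_mult_right has_bochner_integral_PiM_prod S sigma_finite_lborel)
       (simp add: has_bochner_integral_iff)
  have f_ge: "L * (\<Prod>j\<in>S. indicator {0..1} (u j)) \<le> f u" for u
  proof (cases "\<forall>j\<in>S. u j \<in> {0..1}")
    case True
    then have "(\<Prod>j\<in>S. indicator {0..1} (u j)) = (1::real)" by (intro prod.neutral) auto
    moreover have "L \<le> f u"
      unfolding L_def A_def f_def s_def
      by (rule laplace_integrand_ge_on_unit_box[OF lam]) (use True in auto)
    ultimately show ?thesis by simp
  next
    case False
    then have "(\<Prod>j\<in>S. indicator {0..1} (u j)) = (0::real)"
      using S by (auto simp: prod_zero_iff indicator_def)
    then show ?thesis using f_nonneg by simp
  qed
  have meas: "f \<in> borel_measurable P"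
    unfolding f_def P_def
    by (rule measurable_laplace_integrand[OF S I]) simp_all
  have f_int: "integrable P f"
    by (rule Bochner_Integration.integrable_bound[OF integrable.intros[OF upper] meas])
       (use f_nonneg f_le in \<open>auto intro!: AE_I2 simp: abs_of_nonneg intro: order_trans[OF _ abs_ge_self]\<close>)
  have Z: "Z = integral\<^sup>L P f"
    by (simp add: Z_def P_def f_def)
  have "Z \<le> K * (\<Prod>j\<in>S. sqrt (2 * pi / m))"
    unfolding Z has_bochner_integral_integral_eq[OF upper, symmetric]
    by (rule integral_mono[OF f_int integrable.intros[OF upper] f_le])
  then have Z_le: "Z \<le> K * sqrt (2 * pi / m) ^ card S" by simp
  have "L * (\<Prod>j\<in>S. 1) \<le> Z"
    unfolding Z has_bochner_integral_integral_eq[OF lower, symmetric]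
    by (rule integral_mono[OF integrable.intros[OF lower] f_int f_ge])
  then have Z_ge: "L \<le> Z" by simp
  have "ln Z \<le> ln (K * sqrt (2 * pi / m) ^ card S)"
    using Z_le Z_ge KL by simp
  also have "\<dots> = ln K + s * ln (sqrt (2 * pi / m))"
    using KL m_pos by (subst ln_mult) (simp_all add: ln_realpow s_def)
  also have "\<dots> = s * ln (lam / 2) + s / 2 * ln (2 * pi / m) - lam * (\<Sum>j\<in>S. \<bar>b j\<bar>) + (1/2) * (\<Sum>j\<in>S. w j * c j)"
    using lam m_pos by (simp add: K_def ln_mult ln_realpow ln_sqrt s_def)
  finally show "ln Z \<le> s * ln (lam / 2) + s / 2 * ln (2 * pi / m) - lam * (\<Sum>j\<in>S. \<bar>b j\<bar>)
      + (1/2) * (\<Sum>j\<in>S. w j * c j)" .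
  have "s * ln (lam / 2) - (1/2) * (\<Sum>k\<in>I. (A k)\<^sup>2) - (\<Sum>k\<in>I. A k * \<bar>e k\<bar>) - lam * s = ln L"
    using lam by (simp add: L_def ln_mult ln_realpow s_def)
  also have "\<dots> \<le> ln Z" using Z_ge KL by simp
  finally show "s * ln (lam / 2) - (1/2) * (\<Sum>k\<in>I. (A k)\<^sup>2) - (\<Sum>k\<in>I. A k * \<bar>e k\<bar>) - lam * s \<le> ln Z" .
qed

text \<open>With \<open>B\<close> the inverse Gram matrix, the exponent in the upper bound contains half of the quadratic form
\<open>w' B w\<close>, where \<open>w = x' e - lam * sgn b\<close>. The noise part has covariance equal to the Gram matrix, so
it contributes the trace of the identity, which is \<open>card S\<close>; the shift contributes at most
\<open>lam\<^sup>2 * card S / m\<close>, and the cross terms have mean zero.\<close>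
lemma expected_ln_laplace_evidence_le:
  fixes x :: "'k \<Rightarrow> nat \<Rightarrow> real" and b :: "nat \<Rightarrow> real"
  assumes lam: "0 < lam" and m_pos: "0 < m" and S: "finite S" and I: "finite I"
    and m: "\<And>h. m * (\<Sum>j\<in>S. (h j)\<^sup>2) \<le> (\<Sum>k\<in>I. (\<Sum>j\<in>S. x k j * h j)\<^sup>2)"
  shows "(\<integral>y. ln (\<integral>u. laplace_integrand x I S b lam (\<lambda>k. y k - \<mu> k) u \<partial>(\<Pi>\<^sub>M j\<in>S. lborel))
            \<partial>gaussian_PiM I \<mu>)
    \<le> real (card S) / 2 * (1 + 2 * ln (lam / 2) + ln (2 * pi / m) + lam\<^sup>2 / m)
       - lam * (\<Sum>j\<in>S. \<bar>b j\<bar>)"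
proof -
  interpret prob_space "gaussian_PiM I \<mu>" by (rule prob_space_gaussian_PiM)
  define s where "s = real (card S)"
  define N where "N = gaussian_PiM I \<mu>"
  define Z where "Z y = (\<integral>u. laplace_integrand x I S b lam (\<lambda>k. y k - \<mu> k) u \<partial>(\<Pi>\<^sub>M j\<in>S. lborel))" for y
  define A where "A k = (\<Sum>j\<in>S. \<bar>x k j\<bar> * (1 + \<bar>b j\<bar>))" for k
  have "\<forall>j\<in>S. h j = 0" if "(\<Sum>k\<in>I. (\<Sum>j\<in>S. x k j * h j)\<^sup>2) = 0" for h
  proof -
    have "(\<Sum>j\<in>S. (h j)\<^sup>2) \<le> 0" using m[of h] that m_pos by (simp add: mult_le_0_iff)
    then have "(\<Sum>j\<in>S. (h j)\<^sup>2) = 0" by (intro antisym sum_nonneg) auto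
    then show ?thesis using S by (simp add: sum_nonneg_eq_0_iff)
  qed
  then obtain B where B: "\<And>i l. i \<in> S \<Longrightarrow> l \<in> S \<Longrightarrow>
    (\<Sum>j\<in>S. (\<Sum>k\<in>I. x k i * x k j) * B j l) = (if i = l then 1 else 0)"
    using gram_right_inverse[OF S, where x = x and I = I] by blast
  have solve: "(\<Sum>j\<in>S. (\<Sum>k\<in>I. x k i * x k j) * (\<Sum>l\<in>S. B j l * v l)) = v i" if "i \<in> S" for i v
  proof -
    have "(\<Sum>j\<in>S. (\<Sum>k\<in>I. x k i * x k j) * (\<Sum>l\<in>S. B j l * v l))
        = (\<Sum>l\<in>S. (\<Sum>j\<in>S. (\<Sum>k\<in>I. x k i * x k j) * B j l) * v l)"
      unfolding sum_distrib_left[of _ _ S] sum_distrib_right[of _ S] by (subst sum.swap) (simp add: mult.assoc)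
    also have "\<dots> = (\<Sum>l\<in>S. if i = l then v l else 0)"
      using B[OF that] by (intro sum.cong) auto
    also have "\<dots> = v i" using S that by simp
    finally show ?thesis .
  qed
  define w where "w y j = (\<Sum>k\<in>I. x k j * (y k - \<mu> k)) - lam * sgn (b j)" for y j
  define c where "c y j = (\<Sum>l\<in>S. B j l * w y l)" for y j
  define Q where "Q y = (\<Sum>j\<in>S. w y j * c y j)" for y
  have c: "(\<Sum>j\<in>S. (\<Sum>k\<in>I. x k i * x k j) * c y j) = w y i" if "i \<in> S" for i y
    unfolding c_def by (rule solve[OF that])
  note bounds = ln_laplace_evidence_le[where w = "w _" and c = "c _" and e = "\<lambda>k. _ k - \<mu> k", OF lam m_pos S I w_def c m]
    ln_laplace_evidence_ge[where w = "w _" and c = "c _" and e = "\<lambda>k. _ k - \<mu> k", OF lam m_pos S I w_def c m]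
  define R where "R = s * ln (lam / 2) + s / 2 * ln (2 * pi / m) - lam * (\<Sum>j\<in>S. \<bar>b j\<bar>)"
  have upper: "ln (Z y) \<le> R + (1/2) * Q y" for y
    using bounds(1)[of y] by (simp add: Z_def R_def Q_def s_def)
  define R' where "R' = s * ln (lam / 2) - (1/2) * (\<Sum>k\<in>I. (A k)\<^sup>2) - lam * s"
  have lower: "R' - (\<Sum>k\<in>I. A k * \<bar>y k - \<mu> k\<bar>) \<le> ln (Z y)" for y
    using bounds(2)[of y] by (simp add: Z_def R'_def A_def s_def)
  have Q_sum: "Q y = (\<Sum>j\<in>S. \<Sum>l\<in>S. B j l * (w y j * w y l))" for y
    unfolding Q_def c_def by (simp add: sum_distrib_left mult_ac)
  have "has_bochner_integral N Q
      (\<Sum>j\<in>S. \<Sum>l\<in>S. B j l * ((\<Sum>k\<in>I. x k j * x k l) + (lam * sgn (b j)) * (lam * sgn (b l))))"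
    unfolding Q_sum w_def N_def
    by (intro has_bochner_integral_sum has_bochner_integral_mult_right gaussian_PiM_affine_product I)
  then have Q_int: "integrable N Q"
    and Q_eq: "integral\<^sup>L N Q
      = (\<Sum>j\<in>S. \<Sum>l\<in>S. B j l * ((\<Sum>k\<in>I. x k j * x k l) + (lam * sgn (b j)) * (lam * sgn (b l))))"
    by (simp_all add: has_bochner_integral_iff)
  \<comment> \<open>By symmetry of the Gram matrix the sum is the trace of its product with \<open>B\<close>.\<close>
  have trace: "(\<Sum>j\<in>S. \<Sum>l\<in>S. B j l * (\<Sum>k\<in>I. x k j * x k l)) = s"
  proof -
    have "(\<Sum>j\<in>S. \<Sum>l\<in>S. B j l * (\<Sum>k\<in>I. x k j * x k l))
        = (\<Sum>l\<in>S. \<Sum>j\<in>S. (\<Sum>k\<in>I. x k l * x k j) * B j l)"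
      by (subst sum.swap) (simp add: mult_ac)
    also have "\<dots> = s" using B by (simp add: s_def)
    finally show ?thesis .
  qed
  define v where "v j = lam * sgn (b j)" for j
  have "(\<Sum>j\<in>S. \<Sum>l\<in>S. B j l * (v j * v l)) = (\<Sum>j\<in>S. v j * (\<Sum>l\<in>S. B j l * v l))"
    by (simp add: sum_distrib_left mult_ac)
  also have "\<dots> \<le> (\<Sum>j\<in>S. (v j)\<^sup>2) / m"
    by (rule normal_equations_energy_le[OF solve m m_pos])
  also have "\<dots> \<le> (\<Sum>j\<in>S. lam\<^sup>2) / m"
    using m_pos by (intro divide_right_mono sum_mono) (auto simp: v_def power_mult_distrib sgn_if)
  finally have "integral\<^sup>L N Q \<le> s + s * lam\<^sup>2 / m"
    unfolding Q_eq distrib_left sum.distrib trace by (simp add: v_def s_def)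
  have Z_meas: "Z \<in> borel_measurable N"
  proof -
    interpret P: product_sigma_finite "\<lambda>_::nat. lborel :: real measure"
      by (rule product_sigma_finite.intro) (rule sigma_finite_lborel)
    interpret P': sigma_finite_measure "\<Pi>\<^sub>M j\<in>S. (lborel :: real measure)"
      by (rule P.sigma_finite) (rule S)
    have fst_coord: "(\<lambda>q. fst q k) \<in> borel_measurable (gaussian_PiM I \<mu> \<Otimes>\<^sub>M (\<Pi>\<^sub>M j\<in>S. (lborel :: real measure)))"
      if "k \<in> I" for k
    proof (rule measurable_compose[OF measurable_fst])
      show "(\<lambda>y. y k) \<in> borel_measurable (gaussian_PiM I \<mu>)"
        using measurable_component_singleton[OF that, of "\<lambda>i. density lborel (normal_density (\<mu> i) 1)"] by simp
    qed
    have snd_coord: "(\<lambda>q. snd q j) \<in> borel_measurable (gaussian_PiM I \<mu> \<Otimes>\<^sub>M (\<Pi>\<^sub>M j\<in>S. (lborel :: real measure)))"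
      if "j \<in> S" for j
    proof (rule measurable_compose[OF measurable_snd])
      show "(\<lambda>u. u j) \<in> borel_measurable (\<Pi>\<^sub>M j\<in>S. (lborel :: real measure))"
        using measurable_component_singleton[OF that, of "\<lambda>_. lborel :: real measure"] by simp
    qed
    show ?thesis
      unfolding Z_def N_def
      by (rule P'.borel_measurable_lebesgue_integral, unfold case_prod_beta,
          rule measurable_laplace_integrand[OF S I]) (use fst_coord snd_coord in auto)
  qed
  have low_int: "integrable N (\<lambda>y. R' - (\<Sum>k\<in>I. A k * \<bar>y k - \<mu> k\<bar>))"
  proof -
    have "integrable N (\<lambda>y. \<bar>y k - \<mu> k\<bar>)" if "k \<in> I" for k
      unfolding N_def by (rule integrable_abs, rule integrable.intros, rule gaussian_PiM_mean[OF I that])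
    then have "integrable N (\<lambda>y. \<Sum>k\<in>I. A k * \<bar>y k - \<mu> k\<bar>)"
      by (intro Bochner_Integration.integrable_sum integrable_mult_right)
    then show ?thesis by (simp add: N_def)
  qed
  have up_int: "integrable N (\<lambda>y. R + (1/2) * Q y)"
    unfolding N_def using Q_int[unfolded N_def] by auto
  have Z_int: "integrable N (\<lambda>y. ln (Z y))"
  proof (rule Bochner_Integration.integrable_bound)
    show "integrable N (\<lambda>y. \<bar>R + (1/2) * Q y\<bar> + \<bar>R' - (\<Sum>k\<in>I. A k * \<bar>y k - \<mu> k\<bar>)\<bar>)"
      by (intro Bochner_Integration.integrable_add integrable_abs up_int low_int)
    show "(\<lambda>y. ln (Z y)) \<in> borel_measurable N" using Z_meas by measurable
    show "AE y in N. norm (ln (Z y)) \<le> norm (\<bar>R + (1/2) * Q y\<bar> + \<bar>R' - (\<Sum>k\<in>I. A k * \<bar>y k - \<mu> k\<bar>)\<bar>)"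
    proof (rule AE_I2)
      fix y
      show "norm (ln (Z y)) \<le> norm (\<bar>R + (1/2) * Q y\<bar> + \<bar>R' - (\<Sum>k\<in>I. A k * \<bar>y k - \<mu> k\<bar>)\<bar>)"
        using upper[of y] lower[of y] unfolding real_norm_def by linarith
    qed
  qed
  have "(\<integral>y. ln (Z y) \<partial>N) \<le> (\<integral>y. R + (1/2) * Q y \<partial>N)"
    by (rule integral_mono[OF Z_int up_int upper])
  also have "\<dots> = R + (1/2) * integral\<^sup>L N Q"
    using Q_int prob_space unfolding N_def by simp
  also have "\<dots> \<le> R + (1/2) * (s + s * lam\<^sup>2 / m)"
    using \<open>integral\<^sup>L N Q \<le> _\<close> by simp
  also have "\<dots> = s / 2 * (1 + 2 * ln (lam / 2) + ln (2 * pi / m) + lam\<^sup>2 / m) - lam * (\<Sum>j\<in>S. \<bar>b j\<bar>)"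
    by (simp add: R_def algebra_simps add_divide_distrib)
  finally show ?thesis by (simp add: Z_def N_def s_def)
qed

section \<open>Sparse singular values\<close>

lemma l2_norm_power2: "(l2_norm v)\<^sup>2 = (\<Sum>i<dim_vec v. (v $ i)\<^sup>2)"
  by (simp add: l2_norm_def scalar_prod_def sum_nonneg power2_eq_square lessThan_atLeast0)

lemma l2_norm_nonneg: "0 \<le> l2_norm v"
  by (simp add: l2_norm_def scalar_prod_def sum_nonneg)

lemma mult_mat_vec_nth:
  assumes "X \<in> carrier_mat n p" "\<beta> \<in> carrier_vec p" "k < n"
  shows "(X *\<^sub>v \<beta>) $ k = (\<Sum>j<p. X $$ (k, j) * \<beta> $ j)"
  using assms by (simp add: scalar_prod_def lessThan_atLeast0)

lemma mult_mat_vec_nth_supported: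
  assumes "X \<in> carrier_mat n p" "\<beta> \<in> carrier_vec p" "k < n"
    and "S \<subseteq> {..<p}" "\<And>j. j < p \<Longrightarrow> j \<notin> S \<Longrightarrow> \<beta> $ j = 0"
  shows "(X *\<^sub>v \<beta>) $ k = (\<Sum>j\<in>S. X $$ (k, j) * \<beta> $ j)"
  unfolding mult_mat_vec_nth[OF assms(1-3)]
  by (rule sum.mono_neutral_right) (use assms in auto)

lemma sparse_singular_le:
  assumes "\<beta> \<in> carrier_vec (dim_col X)" "card (supp \<beta>) \<noteq> 0" "real (card (supp \<beta>)) \<le> k"
    and "0 \<le> col_norm X"
  shows "sparse_singular X k \<le> l2_norm (X *\<^sub>v \<beta>) / (col_norm X * l2_norm \<beta>)"
  unfolding sparse_singular_def
  by (rule cInf_lower, use assms in blast)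
     (intro bdd_belowI[of _ 0], use assms(4) in \<open>auto simp: l2_norm_nonneg\<close>)

lemma l2_norm_pos_iff_supp: "0 < l2_norm \<beta> \<longleftrightarrow> card (supp \<beta>) \<noteq> 0"
proof -
  have "(l2_norm \<beta>)\<^sup>2 = 0 \<longleftrightarrow> supp \<beta> = {}"
    by (auto simp: l2_norm_power2 supp_def sum_nonneg_eq_0_iff)
  moreover have "finite (supp \<beta>)" by (simp add: supp_def)
  ultimately show ?thesis
    using l2_norm_nonneg[of \<beta>] by (simp add: less_le)
qed

text \<open>Squaring clears both square roots and the quotient in the definition of the sparse singular value,
and the resulting inequality also covers the zero vector.\<close>
lemma sparse_singular_power2_le:
  assumes "X \<in> carrier_mat n p" "\<beta> \<in> carrier_vec p" "real (card (supp \<beta>)) \<le> k"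
    and "0 < col_norm X" "0 \<le> sparse_singular X k"
  shows "(sparse_singular X k)\<^sup>2 * (col_norm X)\<^sup>2 * (\<Sum>j<p. (\<beta> $ j)\<^sup>2) \<le> (\<Sum>i<n. ((X *\<^sub>v \<beta>) $ i)\<^sup>2)"
proof (cases "card (supp \<beta>) = 0")
  case True
  then have "l2_norm \<beta> = 0"
    using l2_norm_pos_iff_supp[of \<beta>] l2_norm_nonneg[of \<beta>] by linarith
  then have "(\<Sum>j<p. (\<beta> $ j)\<^sup>2) = 0"
    using l2_norm_power2[of \<beta>] assms(2) by auto
  then show ?thesis by (simp add: sum_nonneg)
next
  case False
  then have "sparse_singular X k * (col_norm X * l2_norm \<beta>) \<le> l2_norm (X *\<^sub>v \<beta>)"
    using sparse_singular_le[of \<beta> X k] assms l2_norm_pos_iff_supp[of \<beta>]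
    by (simp add: pos_le_divide_eq)
  then have "(sparse_singular X k * (col_norm X * l2_norm \<beta>))\<^sup>2 \<le> (l2_norm (X *\<^sub>v \<beta>))\<^sup>2"
    using assms(4,5) by (intro power_mono) (auto simp: l2_norm_nonneg)
  then show ?thesis
    using assms(1,2) by (simp add: power_mult_distrib l2_norm_power2 mult.assoc)
qed

text \<open>The first \<open>n + 1\<close> columns are linearly dependent: padding them with a zero row gives a singular
square matrix.\<close>
lemma wide_matrix_sparse_kernel_vector:
  fixes X :: "real mat"
  assumes X: "X \<in> carrier_mat n p" and "n < p"
  obtains v where "v \<in> carrier_vec p" "supp v \<noteq> {}" "supp v \<subseteq> {..n}" "X *\<^sub>v v = 0\<^sub>v n"
proof -
  define A where "A = mat (Suc n) (Suc n) (\<lambda>(i, j). if i < n then X $$ (i, j) else 0)"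
  have A: "A \<in> carrier_mat (Suc n) (Suc n)" by (simp add: A_def)
  have "A\<^sup>T *\<^sub>v unit_vec (Suc n) n = 0\<^sub>v (Suc n)"
    by (rule eq_vecI) (auto simp: A_def)
  moreover have "unit_vec (Suc n) n \<noteq> (0\<^sub>v (Suc n) :: real vec)"
    by (metis index_unit_vec(1) index_zero_vec(1) lessI zero_neq_one)
  ultimately have "det (A\<^sup>T) = 0"
    using A by (subst det_0_iff_vec_prod_zero[of _ "Suc n"]) (auto intro!: exI[of _ "unit_vec (Suc n) n"])
  then have "det A = 0" using A by (simp add: det_transpose)
  then obtain u where u: "u \<in> carrier_vec (Suc n)" "u \<noteq> 0\<^sub>v (Suc n)" "A *\<^sub>v u = 0\<^sub>v (Suc n)"
    using det_0_iff_vec_prod_zero[OF A] by blast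
  define v where "v = vec p (\<lambda>j. if j \<le> n then u $ j else 0)"
  have v: "v \<in> carrier_vec p" "supp v \<subseteq> {..n}" by (auto simp: v_def supp_def split: if_splits)
  obtain j where "j < Suc n" "u $ j \<noteq> 0"
    using u(1,2) by (metis carrier_vecD eq_vecI index_zero_vec)
  then have "j \<in> supp v" using \<open>n < p\<close> by (auto simp: supp_def v_def)
  moreover have "X *\<^sub>v v = 0\<^sub>v n"
  proof (rule eq_vecI)
    fix i assume "i < dim_vec (0\<^sub>v n :: real vec)"
    then have i: "i < n" by simp
    have "(X *\<^sub>v v) $ i = (\<Sum>j\<in>{..n}. X $$ (i, j) * v $ j)"
      by (rule mult_mat_vec_nth_supported[OF X v(1) i]) (use \<open>n < p\<close> in \<open>auto simp: v_def\<close>)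
    also have "\<dots> = (\<Sum>j<Suc n. A $$ (i, j) * u $ j)"
      unfolding lessThan_Suc_atMost
      by (rule sum.cong) (use i \<open>n < p\<close> in \<open>auto simp: v_def A_def\<close>)
    also have "\<dots> = (A *\<^sub>v u) $ i"
      using mult_mat_vec_nth[OF A u(1), of i] i by simp
    finally show "(X *\<^sub>v v) $ i = 0\<^sub>v n $ i" using u(3) i by simp
  qed (use X in simp)
  ultimately show ?thesis using v that by blast
qed

text \<open>A kernel vector with at most \<open>n + 1\<close> nonzero entries makes the sparse singular value vanish as soon
as the sparsity level reaches \<open>n + 1\<close>.\<close>
lemma sparse_singular_wide_matrix:
  assumes X: "X \<in> carrier_mat n p" and "n < p" and "0 < col_norm X"
    and pos: "0 < sparse_singular X k"
  shows "k < real n + 1"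
proof (rule ccontr)
  assume k: "\<not> k < real n + 1"
  obtain v where v: "v \<in> carrier_vec p" "supp v \<noteq> {}" "supp v \<subseteq> {..n}" "X *\<^sub>v v = 0\<^sub>v n"
    using wide_matrix_sparse_kernel_vector[OF X \<open>n < p\<close>] .
  have "card (supp v) \<le> card {..n}" using v(3) by (intro card_mono) auto
  then have "real (card (supp v)) \<le> k" using k by simp
  moreover have "card (supp v) \<noteq> 0" using v(2,3) finite_subset[OF v(3)] by simp
  ultimately have "sparse_singular X k \<le> 0"
    using sparse_singular_le[of v X k] v(1,4) X \<open>0 < col_norm X\<close> by (simp add: l2_norm_def)
  with pos show False by simp
qed

text \<open>Differences of two columns are images of 2-sparse vectors, so any two columns of a design with
positive sparse singular value \<open>\<psi>\<close> are at distance at least \<open>\<psi> * sqrt (2 * n)\<close>. Hence no two of them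
fall into the same cell of the grid with mesh \<open>\<psi>\<close>, whose cubes have diameter \<open>\<psi> * sqrt n\<close>. The columns
have entries of size at most \<open>sqrt n\<close>, so the number of available cells is bounded in terms of \<open>n\<close>
and \<open>\<psi>\<close>, and for \<open>n \<le> 1 / \<psi>\<^sup>2\<close> in terms of \<open>\<psi>\<close> alone.\<close>
lemma ln_dim_le_of_sparse_singular:
  assumes X: "X \<in> carrier_mat n p" and p: "0 < p" and n: "0 < n"
    and col: "\<And>j. j < p \<Longrightarrow> l2_norm (col X j) = sqrt (real n)" and norm: "col_norm X = sqrt (real n)"
    and k: "2 \<le> k" and pos: "0 < sparse_singular X k"
  defines "r \<equiv> 1 / (sparse_singular X k)\<^sup>2"
  assumes nr: "real n \<le> r"
  shows "ln (real p) \<le> 2 * r * (r + 1)"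
proof -
  define \<psi> where "\<psi> = sparse_singular X k"
  have \<psi>: "0 < \<psi>" using pos by (simp add: \<psi>_def)
  define N where "N = nat \<lceil>r\<rceil>"
  define cell where "cell j = (\<lambda>i\<in>{..<n}. \<lfloor>X $$ (i, j) / \<psi>\<rfloor>)" for j
  have r: "0 < r" using \<psi> by (simp add: r_def \<psi>_def)
  have N: "r \<le> real N" "real N \<le> r + 1" using r unfolding N_def by linarith+
  have entry: "\<bar>X $$ (i, j)\<bar> / \<psi> \<le> real N" if "i < n" "j < p" for i j
  proof -
    have "(X $$ (i, j))\<^sup>2 \<le> (\<Sum>i<n. (X $$ (i, j))\<^sup>2)"
      by (rule member_le_sum[of i]) (use that in auto)
    also have "\<dots> = (l2_norm (col X j))\<^sup>2" using X that by (simp add: l2_norm_power2)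
    also have "\<dots> = real n" using col[OF that(2)] by simp
    finally have "(X $$ (i, j))\<^sup>2 / \<psi>\<^sup>2 \<le> real n / \<psi>\<^sup>2" by (simp add: divide_right_mono)
    also have "\<dots> = real n * r" by (simp add: r_def \<psi>_def)
    also have "\<dots> \<le> r * r" using nr r by (intro mult_right_mono) auto
    finally have "(\<bar>X $$ (i, j)\<bar> / \<psi>)\<^sup>2 \<le> r\<^sup>2" by (simp add: power_divide power2_eq_square)
    then have "\<bar>X $$ (i, j)\<bar> / \<psi> \<le> r" by (rule power2_le_imp_le) (use r in auto)
    then show ?thesis using N by simp
  qed
  have "cell ` {..<p} \<subseteq> {..<n} \<rightarrow>\<^sub>E {- int N..int N}"
  proof (intro image_subsetI PiE_I)
    fix j i assume ji: "j \<in> {..<p}" "i \<in> {..<n}"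
    have "\<bar>X $$ (i, j) / \<psi>\<bar> \<le> real N" using entry[of i j] ji \<psi> by simp
    then have "- int N \<le> \<lfloor>X $$ (i, j) / \<psi>\<rfloor> \<and> \<lfloor>X $$ (i, j) / \<psi>\<rfloor> \<le> int N" by linarith
    then show "cell j i \<in> {- int N..int N}"
      using ji by (simp add: cell_def)
  qed (auto simp: cell_def)
  moreover have "inj_on cell {..<p}"
  proof (rule inj_onI, rule ccontr)
    fix j l assume jl: "j \<in> {..<p}" "l \<in> {..<p}" "cell j = cell l" "j \<noteq> l"
    define \<beta> :: "real vec" where "\<beta> = unit_vec p j - unit_vec p l"
    have \<beta>: "\<beta> \<in> carrier_vec p" by (simp add: \<beta>_def)
    have \<beta>_nth: "\<beta> $ i = (if i = j then 1 else if i = l then - 1 else 0)" if "i < p" for i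
      using that jl by (auto simp: \<beta>_def)
    have "supp \<beta> \<subseteq> {j, l}" using \<beta> by (auto simp: supp_def \<beta>_nth split: if_splits)
    then have "card (supp \<beta>) \<le> card {j, l}" by (intro card_mono) auto
    then have "real (card (supp \<beta>)) \<le> k" using jl(4) k by simp
    from sparse_singular_power2_le[OF X \<beta> this] pos norm n
    have "\<psi>\<^sup>2 * real n * (\<Sum>i<p. (\<beta> $ i)\<^sup>2) \<le> (\<Sum>i<n. ((X *\<^sub>v \<beta>) $ i)\<^sup>2)"
      by (simp add: \<psi>_def)
    moreover have "(\<Sum>i<p. (\<beta> $ i)\<^sup>2) = 2"
    proof -
      have "(\<Sum>i<p. (\<beta> $ i)\<^sup>2) = (\<Sum>i\<in>{j, l}. (\<beta> $ i)\<^sup>2)"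
        by (rule sum.mono_neutral_right) (use jl \<beta>_nth in auto)
      then show ?thesis using jl by (simp add: \<beta>_nth)
    qed
    moreover have "(\<Sum>i<n. ((X *\<^sub>v \<beta>) $ i)\<^sup>2) \<le> (\<Sum>i<n. \<psi>\<^sup>2)"
    proof (rule sum_mono)
      fix i assume i: "i \<in> {..<n}"
      have "(X *\<^sub>v \<beta>) $ i = (\<Sum>m\<in>{j, l}. X $$ (i, m) * \<beta> $ m)"
        by (rule mult_mat_vec_nth_supported[OF X \<beta>]) (use i jl \<beta>_nth in auto)
      then have eq: "(X *\<^sub>v \<beta>) $ i = X $$ (i, j) - X $$ (i, l)"
        using jl by (simp add: \<beta>_nth)
      have "\<lfloor>X $$ (i, j) / \<psi>\<rfloor> = \<lfloor>X $$ (i, l) / \<psi>\<rfloor>"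
        using fun_cong[OF jl(3), of i] i by (simp add: cell_def)
      then have "\<bar>X $$ (i, j) / \<psi> - X $$ (i, l) / \<psi>\<bar> \<le> 1" by linarith
      then have "\<bar>X $$ (i, j) - X $$ (i, l)\<bar> \<le> \<psi>"
        using \<psi> by (simp add: diff_divide_distrib[symmetric])
      then show "((X *\<^sub>v \<beta>) $ i)\<^sup>2 \<le> \<psi>\<^sup>2"
        unfolding eq using \<psi> by (simp add: abs_le_square_iff[symmetric])
    qed
    moreover have "0 < real n * \<psi>\<^sup>2" using \<psi> n by simp
    ultimately show False by (simp add: mult.commute[of "\<psi>\<^sup>2"])
  qed
  ultimately have "card {..<p} \<le> card ({..<n} \<rightarrow>\<^sub>E {- int N..int N})"
    by (intro card_inj_on_le[of cell]) (auto intro: finite_PiE)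
  then have "p \<le> nat (2 * int N + 1) ^ n" by (simp add: card_PiE)
  moreover have "nat (2 * int N + 1) = 2 * N + 1" by simp
  ultimately have "p \<le> (2 * N + 1) ^ n" by simp
  then have "real p \<le> real ((2 * N + 1) ^ n)" by (rule of_nat_mono)
  then have "real p \<le> (2 * real N + 1) ^ n" by (simp add: add.commute)
  then have "ln (real p) \<le> ln ((2 * real N + 1) ^ n)"
    using p by (subst ln_le_cancel_iff) auto
  also have "\<dots> = real n * ln (1 + 2 * real N)" by (simp add: ln_realpow add.commute)
  also have "\<dots> \<le> r * (2 * (r + 1))"
  proof (rule mult_mono)
    have "ln (1 + 2 * real N) \<le> 2 * real N" by (rule ln_add_one_self_le_self) simp
    then show "ln (1 + 2 * real N) \<le> 2 * (r + 1)" using N by simp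
  qed (use nr r in auto)
  finally show ?thesis by (simp add: mult_ac)
qed

section \<open>The expected log marginal likelihood\<close>

lemma integrand_eq_laplace_integrand:
  assumes X: "X \<in> carrier_mat n p" and \<beta>0: "\<beta>0 \<in> carrier_vec p"
  shows "likelihood_ratio X (embed p (supp \<beta>0) u) \<beta>0 (vec n y) *
      laplace_prior lam (supp \<beta>0) (embed p (supp \<beta>0) u)
    = laplace_integrand (\<lambda>k j. X $$ (k, j)) {..<n} (supp \<beta>0) (\<lambda>j. \<beta>0 $ j) lam
        (\<lambda>k. y k - (X *\<^sub>v \<beta>0) $ k) u"
proof -
  let ?S = "supp \<beta>0"
  let ?d = "embed p ?S u - \<beta>0"
  have S: "?S \<subseteq> {..<p}" and S': "\<And>j. j < p \<Longrightarrow> j \<notin> ?S \<Longrightarrow> \<beta>0 $ j = 0"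
    using \<beta>0 by (auto simp: supp_def)
  have d: "?d \<in> carrier_vec p" using \<beta>0 by (simp add: embed_def)
  have Xd: "(X *\<^sub>v ?d) $ k = (\<Sum>j\<in>?S. X $$ (k, j) * (u j - \<beta>0 $ j))" if "k < n" for k
  proof -
    have "(X *\<^sub>v ?d) $ k = (\<Sum>j\<in>?S. X $$ (k, j) * ?d $ j)"
      by (rule mult_mat_vec_nth_supported[OF X d that S]) (use \<beta>0 S' in \<open>auto simp: embed_def\<close>)
    also have "\<dots> = (\<Sum>j\<in>?S. X $$ (k, j) * (u j - \<beta>0 $ j))"
      by (rule sum.cong) (use \<beta>0 S in \<open>auto simp: embed_def\<close>)
    finally show ?thesis .
  qed
  have quad: "(l2_norm (X *\<^sub>v ?d))\<^sup>2 = (\<Sum>k<n. (\<Sum>j\<in>?S. X $$ (k, j) * (u j - \<beta>0 $ j))\<^sup>2)"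
    using X Xd by (simp add: l2_norm_power2)
  have "(vec n y - X *\<^sub>v \<beta>0) \<bullet> (X *\<^sub>v ?d)
      = (\<Sum>k<n. (vec n y - X *\<^sub>v \<beta>0) $ k * (X *\<^sub>v ?d) $ k)"
    unfolding scalar_prod_def lessThan_atLeast0 using X by (intro sum.cong) auto
  also have "\<dots> = (\<Sum>k<n. (y k - (X *\<^sub>v \<beta>0) $ k) * (\<Sum>j\<in>?S. X $$ (k, j) * (u j - \<beta>0 $ j)))"
    by (rule sum.cong[OF refl]) (use X Xd in auto)
  finally have lin: "(vec n y - X *\<^sub>v \<beta>0) \<bullet> (X *\<^sub>v ?d)
      = (\<Sum>k<n. (y k - (X *\<^sub>v \<beta>0) $ k) * (\<Sum>j\<in>?S. X $$ (k, j) * (u j - \<beta>0 $ j)))" .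
  have "l1_norm (embed p ?S u) = (\<Sum>i<p. \<bar>if i \<in> ?S then u i else 0\<bar>)"
    by (simp add: l1_norm_def embed_def)
  also have "\<dots> = (\<Sum>j\<in>?S. \<bar>u j\<bar>)"
    by (rule sum.mono_neutral_cong_right) (use S in auto)
  finally show ?thesis
    unfolding likelihood_ratio_def laplace_prior_def laplace_integrand_def quad lin by simp
qed

lemma l1_norm_eq_sum_supp: "l1_norm \<beta> = (\<Sum>j\<in>supp \<beta>. \<bar>\<beta> $ j\<bar>)"
  unfolding l1_norm_def by (rule sum.mono_neutral_right) (auto simp: supp_def)

text \<open>The sparse singular value at any level \<open>k \<ge> card (supp \<beta>0)\<close> provides the coercivity constant
\<open>m = n * \<psi>\<^sup>2\<close> for the columns in the support.\<close>
lemma expected_ln_marginal_likelihood_le: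
  assumes X: "X \<in> carrier_mat n p" and \<beta>0: "\<beta>0 \<in> carrier_vec p" and lam: "0 < lam"
    and norm: "col_norm X = sqrt (real n)" and n: "0 < n"
    and k: "real (card (supp \<beta>0)) \<le> k" and \<psi>: "0 < sparse_singular X k"
  shows "(\<integral>y. ln (marginal_likelihood X \<beta>0 (supp \<beta>0) (laplace_prior lam (supp \<beta>0)) (vec n y))
           \<partial>std_gaussian (X *\<^sub>v \<beta>0))
    \<le> real (card (supp \<beta>0)) / 2 *
        (1 + 2 * ln (lam / 2) + ln (2 * pi / (real n * (sparse_singular X k)\<^sup>2))
           + lam\<^sup>2 / (real n * (sparse_singular X k)\<^sup>2))
      - lam * l1_norm \<beta>0"
proof -
  let ?S = "supp \<beta>0"
  have S: "?S \<subseteq> {..<p}" using \<beta>0 by (auto simp: supp_def)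
  have coercive: "real n * (sparse_singular X k)\<^sup>2 * (\<Sum>j\<in>?S. (h j)\<^sup>2)
      \<le> (\<Sum>i<n. (\<Sum>j\<in>?S. X $$ (i, j) * h j)\<^sup>2)" for h
  proof -
    define \<beta> where "\<beta> = embed p ?S h"
    have \<beta>: "\<beta> \<in> carrier_vec p" by (simp add: \<beta>_def embed_def)
    have "supp \<beta> \<subseteq> ?S" by (auto simp: \<beta>_def embed_def supp_def split: if_splits)
    then have "card (supp \<beta>) \<le> card ?S" by (intro card_mono finite_subset[OF S]) auto
    then have "real (card (supp \<beta>)) \<le> k" using k by simp
    from sparse_singular_power2_le[OF X \<beta> this] norm n \<psi>
    have "(sparse_singular X k)\<^sup>2 * real n * (\<Sum>j<p. (\<beta> $ j)\<^sup>2) \<le> (\<Sum>i<n. ((X *\<^sub>v \<beta>) $ i)\<^sup>2)"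
      by simp
    also have "(\<Sum>j<p. (\<beta> $ j)\<^sup>2) = (\<Sum>j\<in>?S. (h j)\<^sup>2)"
      by (rule sum.mono_neutral_cong_right) (use S in \<open>auto simp: \<beta>_def embed_def\<close>)
    also have "(\<Sum>i<n. ((X *\<^sub>v \<beta>) $ i)\<^sup>2) = (\<Sum>i<n. (\<Sum>j\<in>?S. X $$ (i, j) * h j)\<^sup>2)"
    proof (rule sum.cong[OF refl])
      fix i assume "i \<in> {..<n}"
      then have "(X *\<^sub>v \<beta>) $ i = (\<Sum>j\<in>?S. X $$ (i, j) * \<beta> $ j)"
        by (intro mult_mat_vec_nth_supported[OF X \<beta> _ S]) (auto simp: \<beta>_def embed_def)
      also have "\<dots> = (\<Sum>j\<in>?S. X $$ (i, j) * h j)"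
        by (rule sum.cong) (use S in \<open>auto simp: \<beta>_def embed_def\<close>)
      finally show "((X *\<^sub>v \<beta>) $ i)\<^sup>2 = (\<Sum>j\<in>?S. X $$ (i, j) * h j)\<^sup>2" by simp
    qed
    finally show ?thesis by (simp add: mult.commute)
  qed
  have "std_gaussian (X *\<^sub>v \<beta>0) = gaussian_PiM {..<n} (\<lambda>k. (X *\<^sub>v \<beta>0) $ k)"
    using X by (simp add: std_gaussian_def)
  moreover have "marginal_likelihood X \<beta>0 ?S (laplace_prior lam ?S) (vec n y)
    = (\<integral>u. laplace_integrand (\<lambda>k j. X $$ (k, j)) {..<n} ?S (\<lambda>j. \<beta>0 $ j) lam
        (\<lambda>k. y k - (X *\<^sub>v \<beta>0) $ k) u \<partial>(\<Pi>\<^sub>M j\<in>?S. lborel))" for y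
    using X by (simp add: marginal_likelihood_def integrand_eq_laplace_integrand[OF X \<beta>0])
  ultimately show ?thesis
    using expected_ln_laplace_evidence_le[OF lam _ finite_subset[OF S] _ coercive,
        where \<mu> = "\<lambda>k. (X *\<^sub>v \<beta>0) $ k" and b = "\<lambda>j. \<beta>0 $ j"] n \<psi>
    by (simp add: l1_norm_eq_sum_supp)
qed

section \<open>The choice of the constant\<close>

text \<open>Both terms on the left are at most \<open>lam\<^sup>2 * r\<close>. For \<open>r < n\<close> the first term on the right
absorbs them. Otherwise \<open>lam\<close> is bounded by assumption and \<open>sqrt (s / n * l)\<close> is at least \<open>\<psi>\<close>,
so a constant multiple of this square root does.\<close>
lemma ln_ratio_plus_quadratic_le:
  fixes \<psi> lam n s l L :: real
  defines "r \<equiv> 1 / \<psi>\<^sup>2"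
  assumes "0 < \<psi>" "0 < lam" "1 \<le> n" "1 \<le> s" "1 \<le> l" "1 \<le> L" "0 \<le> K"
    and small: "n \<le> r \<Longrightarrow> lam\<^sup>2 \<le> K"
  shows "ln (lam\<^sup>2 / (16 * \<psi>\<^sup>2)) + lam\<^sup>2 / (n * \<psi>\<^sup>2) \<le> 2 * lam\<^sup>2 * (n * L) + 2 * r * K / \<psi> * sqrt (s / n * l)"
proof -
  have r: "0 < r" using \<open>0 < \<psi>\<close> by (simp add: r_def)
  have "ln (lam\<^sup>2 / (16 * \<psi>\<^sup>2)) \<le> lam\<^sup>2 / (16 * \<psi>\<^sup>2)"
    using \<open>0 < \<psi>\<close> \<open>0 < lam\<close> by (intro ln_bound) simp
  also have "\<dots> \<le> lam\<^sup>2 * r" using \<open>0 < \<psi>\<close> by (simp add: r_def field_simps)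
  finally have ln_le: "ln (lam\<^sup>2 / (16 * \<psi>\<^sup>2)) \<le> lam\<^sup>2 * r" .
  have "lam\<^sup>2 / (n * \<psi>\<^sup>2) = lam\<^sup>2 * r / n" by (simp add: r_def)
  also have "\<dots> \<le> lam\<^sup>2 * r / 1" using r \<open>1 \<le> n\<close> by (intro divide_left_mono) auto
  finally have quad_le: "lam\<^sup>2 / (n * \<psi>\<^sup>2) \<le> lam\<^sup>2 * r" by simp
  show ?thesis
  proof (cases "n \<le> r")
    case True
    have "\<psi> = sqrt (1 / r)" using \<open>0 < \<psi>\<close> by (simp add: r_def)
    also have "\<dots> \<le> sqrt (s / n * l)"
    proof (rule real_sqrt_le_mono)
      have "1 / r \<le> 1 / n" using True \<open>1 \<le> n\<close> by (intro divide_left_mono) auto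
      also have "\<dots> \<le> s / n" using \<open>1 \<le> s\<close> \<open>1 \<le> n\<close> by (intro divide_right_mono) auto
      also have "\<dots> \<le> s / n * l"
        using mult_left_mono[OF \<open>1 \<le> l\<close>, of "s / n"] \<open>1 \<le> s\<close> \<open>1 \<le> n\<close> by simp
      finally show "1 / r \<le> s / n * l" .
    qed
    finally have "1 \<le> sqrt (s / n * l) / \<psi>" using \<open>0 < \<psi>\<close> by simp
    then have "2 * r * K * 1 \<le> 2 * r * K * (sqrt (s / n * l) / \<psi>)"
      using r \<open>0 \<le> K\<close> by (intro mult_left_mono) auto
    moreover have "lam\<^sup>2 * r \<le> K * r" using small[OF True] r by (intro mult_right_mono) auto
    moreover have "0 \<le> 2 * lam\<^sup>2 * (n * L)" using \<open>1 \<le> n\<close> \<open>1 \<le> L\<close> by simp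
    ultimately show ?thesis using ln_le quad_le by (simp add: mult_ac)
  next
    case False
    have "lam\<^sup>2 * r \<le> lam\<^sup>2 * (n * L)"
    proof (rule mult_left_mono)
      have "r \<le> n * 1" using False by simp
      also have "\<dots> \<le> n * L" using \<open>1 \<le> n\<close> \<open>1 \<le> L\<close> by (intro mult_left_mono) auto
      finally show "r \<le> n * L" .
    qed simp
    moreover have "0 \<le> 2 * r * K / \<psi> * sqrt (s / n * l)"
      using r \<open>0 \<le> K\<close> \<open>0 < \<psi>\<close> \<open>1 \<le> n\<close> \<open>1 \<le> s\<close> \<open>1 \<le> l\<close> by simp
    ultimately show ?thesis using ln_le quad_le by linarith
  qed
qed

theorem lemma19:
  fixes A4 M C :: real
  assumes "A4 > 0" and "M > 0" and "C > 0"
  shows "\<exists>C0 :: real \<Rightarrow> real \<Rightarrow> real \<Rightarrow> real.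
    \<forall>(n::nat) (p::nat) (X::real mat) (\<beta>0::real vec) (sn::nat) (lam::real) (b::real) (d::real).
      0 < n \<longrightarrow> n < p \<longrightarrow> X \<in> carrier_mat n p \<longrightarrow>
      (\<forall>j<p. l2_norm (col X j) = sqrt (real n)) \<longrightarrow>
      0 < lam \<longrightarrow> 0 < b \<longrightarrow> b < 1 \<longrightarrow> 0 < d \<longrightarrow>
      \<beta>0 \<in> beta_min_class X A4 lam sn M \<longrightarrow>
      design_assumption X A4 M C lam (supp \<beta>0) b d \<longrightarrow>
      (let S0 = supp \<beta>0; s = real (card S0) in
        (\<integral>y. ln (marginal_likelihood X \<beta>0 S0 (laplace_prior lam S0) (vec n y))
           \<partial>std_gaussian (X *\<^sub>v \<beta>0))
        \<le> s / 2 * (1 + 2 * lam\<^sup>2 * (real n * ln (real p) powr d)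
                    + C0 (psi_tilde X A4 lam S0) (compat_number X S0) b * sqrt (s / real n * ln (real p))
                    + ln (8 * pi / real n))
          - lam * l1_norm \<beta>0)"
proof -
  \<comment> \<open>\<open>K\<close> bounds \<open>lam\<^sup>2\<close> in the range \<open>n \<le> 1 / \<psi>\<^sup>2\<close>; see the fact \<open>small\<close> below.\<close>
  define K where "K \<psi> \<phi> = 8 * (1 / \<psi>\<^sup>2)\<^sup>2 * (1 / \<psi>\<^sup>2 + 1) ^ 3 * \<phi> ^ 4" for \<psi> \<phi> :: real
  define C0 :: "real \<Rightarrow> real \<Rightarrow> real \<Rightarrow> real" where "C0 \<psi> \<phi> b = 2 * (1 / \<psi>\<^sup>2) * K \<psi> \<phi> / \<psi>" for \<psi> \<phi> b
  show ?thesis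
  proof (intro exI[of _ C0] allI impI)
    fix n p :: nat and X :: "real mat" and \<beta>0 :: "real vec" and sn :: nat and lam b d :: real
    assume n: "0 < n" and np: "n < p" and X: "X \<in> carrier_mat n p"
      and col: "\<forall>j<p. l2_norm (col X j) = sqrt (real n)" and lam: "0 < lam" and d: "0 < d"
      and cls: "\<beta>0 \<in> beta_min_class X A4 lam sn M"
    define S where "S = supp \<beta>0"
    define s where "s = real (card S)"
    define \<phi> where "\<phi> = compat_number X S"
    define \<psi> where "\<psi> = psi_tilde X A4 lam S"
    define t where "t = 33 / \<phi>\<^sup>2 * (lam / lambda_bar X)"
    define k where "k = (2 + 3 / A4 + t) * s"
    have \<beta>0: "\<beta>0 \<in> carrier_vec p" and \<phi>: "0 < \<phi>" and \<psi>: "0 < \<psi>"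
      using cls X by (auto simp: beta_min_class_def S_def \<phi>_def \<psi>_def)
    have \<psi>_eq: "\<psi> = sparse_singular X k"
      by (simp add: \<psi>_def psi_tilde_def k_def t_def \<phi>_def s_def)
    have "(\<lambda>j. l2_norm (col X j)) ` {..<dim_col X} = {sqrt (real n)}"
      using X col np by auto
    then have norm: "col_norm X = sqrt (real n)" by (simp add: col_norm_def)
    have lbar: "lambda_bar X = 2 * sqrt (real n) * sqrt (ln (real p))"
      using X norm by (simp add: lambda_bar_def)
    have lbar_pos: "0 < lambda_bar X" using n np by (simp add: lbar)
    have t: "0 \<le> t" using lam lbar_pos by (simp add: t_def)
    have A4: "0 < 3 / A4" using assms by simp
    have k_ge: "2 * s \<le> k"
      unfolding k_def using A4 t by (intro mult_right_mono) (auto simp: s_def)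
    define R where "R = 1 + 2 * lam\<^sup>2 * (real n * ln (real p) powr d)
      + C0 \<psi> \<phi> b * sqrt (s / real n * ln (real p)) + ln (8 * pi / real n)"
    have "(\<integral>y. ln (marginal_likelihood X \<beta>0 S (laplace_prior lam S) (vec n y)) \<partial>std_gaussian (X *\<^sub>v \<beta>0))
      \<le> s / 2 * (1 + 2 * ln (lam / 2) + ln (2 * pi / (real n * \<psi>\<^sup>2)) + lam\<^sup>2 / (real n * \<psi>\<^sup>2))
         - lam * l1_norm \<beta>0"
      unfolding S_def s_def \<psi>_eq
      by (rule expected_ln_marginal_likelihood_le[OF X \<beta>0 lam norm n])
        (use k_ge \<psi> in \<open>auto simp: \<psi>_eq s_def S_def\<close>)
    also have "\<dots> \<le> s / 2 * R - lam * l1_norm \<beta>0"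
    proof (cases "s = 0")
      case False
      then have s1: "1 \<le> s" by (simp add: s_def Suc_le_eq)
      \<comment> \<open>The sparsity level in \<open>psi_tilde\<close> grows with \<open>lam\<close>, so its being below \<open>n + 1\<close> bounds \<open>lam\<close>.
        As it is also at least \<open>2 * s\<close>, it forces \<open>n \<ge> 2\<close>, hence \<open>p \<ge> 3\<close> and \<open>ln p \<ge> 1\<close>.\<close>
      have "k < real n + 1"
        by (rule sparse_singular_wide_matrix[OF X np]) (use norm n \<psi> in \<open>auto simp: \<psi>_eq\<close>)
      then have "2 < real n + 1" using k_ge s1 by linarith
      then have "3 \<le> p" using np by simp
      have l1: "1 \<le> ln (real p)"
      proof -
        have "exp 1 \<le> (3::real)" by (rule exp_le)
        also have "\<dots> \<le> real p" using \<open>3 \<le> p\<close> by simp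
        finally show ?thesis using \<open>3 \<le> p\<close> by (subst ln_ge_iff) auto
      qed
      have "t * 1 \<le> t * s" using t s1 by (intro mult_left_mono) auto
      also have "t * s \<le> k" unfolding k_def using A4 t s1 by (intro mult_right_mono) auto
      also have "k < real n + 1" by fact
      finally have "lam \<le> (real n + 1) * \<phi>\<^sup>2 * lambda_bar X / 33"
        using \<phi> lbar_pos by (simp add: t_def field_simps)
      also have "\<dots> \<le> (real n + 1) * \<phi>\<^sup>2 * lambda_bar X"
        using lbar_pos by simp
      finally have lam_le: "lam \<le> (real n + 1) * \<phi>\<^sup>2 * lambda_bar X" .
      have small: "lam\<^sup>2 \<le> K \<psi> \<phi>" if nr: "real n \<le> 1 / \<psi>\<^sup>2"
      proof -
        define r where "r = 1 / \<psi>\<^sup>2"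
        have r: "0 < r" using \<psi> by (simp add: r_def)
        have "2 \<le> k" using k_ge s1 by simp
        then have p_le: "ln (real p) \<le> 2 * r * (r + 1)"
          using ln_dim_le_of_sparse_singular[OF X _ n _ norm] col np nr \<psi> unfolding \<psi>_eq r_def by simp
        \<comment> \<open>By \<open>lam_le\<close>, \<open>lam\<close> is bounded in terms of \<open>n\<close>, \<open>\<phi>\<close> and \<open>ln p\<close>, and the number of
          well-separated columns limits \<open>ln p\<close>.\<close>
        have "lam\<^sup>2 \<le> ((real n + 1) * \<phi>\<^sup>2 * lambda_bar X)\<^sup>2"
          using lam_le lam by (intro power_mono) auto
        also have "\<dots> = (real n + 1)\<^sup>2 * \<phi> ^ 4 * (4 * (real n * ln (real p)))"
          using l1 by (simp add: lbar power_mult_distrib power_even_eq[symmetric] mult_ac flip: power_mult)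
        also have "\<dots> \<le> (r + 1)\<^sup>2 * \<phi> ^ 4 * (4 * (r * (2 * r * (r + 1))))"
          using nr r l1 p_le \<phi> unfolding r_def[symmetric]
          by (intro mult_mono power_mono) auto
        also have "\<dots> = K \<psi> \<phi>"
          unfolding K_def r_def[symmetric] by (simp add: power2_eq_square power3_eq_cube)
        finally show ?thesis .
      qed
      have "ln (lam\<^sup>2 / (16 * \<psi>\<^sup>2)) + lam\<^sup>2 / (real n * \<psi>\<^sup>2)
        \<le> 2 * lam\<^sup>2 * (real n * ln (real p) powr d) + C0 \<psi> \<phi> b * sqrt (s / real n * ln (real p))"
        unfolding C0_def
      proof (rule ln_ratio_plus_quadratic_le[OF \<psi> lam _ s1 l1 _ _ small])
        show "1 \<le> ln (real p) powr d" using l1 d by (intro ge_one_powr_ge_zero) auto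
        show "0 \<le> K \<psi> \<phi>" using \<phi> by (simp add: K_def)
      qed (use n in auto)
      \<comment> \<open>The normalizations of the Laplace density and of the Gaussian integral combine into
        \<open>ln (8 * pi / n)\<close> and a function of \<open>lam / \<psi>\<close>.\<close>
      moreover have "2 * ln (lam / 2) + ln (2 * pi / (real n * \<psi>\<^sup>2))
          = ln (8 * pi / real n) + ln (lam\<^sup>2 / (16 * \<psi>\<^sup>2))"
      proof -
        have "2 * ln (lam / 2) + ln (2 * pi / (real n * \<psi>\<^sup>2)) = ln ((lam / 2)\<^sup>2 * (2 * pi / (real n * \<psi>\<^sup>2)))"
          using lam n \<psi> by (subst ln_mult) (simp_all add: ln_realpow)
        also have "(lam / 2)\<^sup>2 * (2 * pi / (real n * \<psi>\<^sup>2)) = (8 * pi / real n) * (lam\<^sup>2 / (16 * \<psi>\<^sup>2))"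
          by (simp add: power_divide field_simps)
        also have "ln \<dots> = ln (8 * pi / real n) + ln (lam\<^sup>2 / (16 * \<psi>\<^sup>2))"
          using lam n \<psi> by (subst ln_mult) simp_all
        finally show ?thesis .
      qed
      ultimately have "1 + 2 * ln (lam / 2) + ln (2 * pi / (real n * \<psi>\<^sup>2)) + lam\<^sup>2 / (real n * \<psi>\<^sup>2) \<le> R"
        unfolding R_def by linarith
      then have "s / 2 * (1 + 2 * ln (lam / 2) + ln (2 * pi / (real n * \<psi>\<^sup>2)) + lam\<^sup>2 / (real n * \<psi>\<^sup>2)) \<le> s / 2 * R"
        using s1 by (intro mult_left_mono) auto
      then show ?thesis by simp
    qed simp
    finally show "let S0 = supp \<beta>0; s = real (card S0) in
        (\<integral>y. ln (marginal_likelihood X \<beta>0 S0 (laplace_prior lam S0) (vec n y))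
           \<partial>std_gaussian (X *\<^sub>v \<beta>0))
        \<le> s / 2 * (1 + 2 * lam\<^sup>2 * (real n * ln (real p) powr d)
                    + C0 (psi_tilde X A4 lam S0) (compat_number X S0) b * sqrt (s / real n * ln (real p))
                    + ln (8 * pi / real n))
          - lam * l1_norm \<beta>0"
      unfolding Let_def S_def[symmetric] s_def[symmetric] \<psi>_def[symmetric] \<phi>_def[symmetric]
      by (simp only: R_def)
  qed
qed

end
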